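(* With probability $1-\tilde{O}(1/n^2)$, the ordering output by the Differentially Private Max Cover/Set Cover algorithm described in the context is $(1-5\eta,O(\log^2 n/\epsilon_0))$-prefix optimal, where $\epsilon_0=\epsilon/(2\log_{1/(1-\eta)}n)$.
   Context: $\mathrm{Lap}(\beta)$ is the Laplace distribution with scale $\beta$ (independent draws); $C_1$ is a constant; $n=|\mathcal{U}|$. Subroutine DP-MaNIS$_\eta$ with privacy parameter $\epsilon'$ on a bipartite graph $(A\cup B,E)$: set $G^{(0)}=(A^{(0)}\cup B^{(0)},E^{(0)})=(A\cup B,E)$, $\epsilon_1=\epsilon'/(C_1'\log n)$; for $a\in A$ let $\tilde D(a)=|N(a)|+\mathrm{Lap}(2/\epsilon_1)$; for $t=0,\dots,C_2'\log n$: each $a\in A^{(t)}$ picks $x_a\in[0,1]$ uniformly; $\varphi^{(t)}(b)$ is the neighbor $a$ of $b$ in $G^{(t)}$ with largest $x_a$; $J^{(t)}=\{a\in A^{(t)}:\sum_{b\in B^{(t)}}\mathbb 1\{\varphi^{(t)}(b)=a\}+\mathrm{Lap}(1/\epsilon_1)\ge(1-4\eta)\tilde D(a)\}$; $B^{(t+1)}=B^{(t)}\setminus N_{G^{(t)}}(J^{(t)})$; $A^{(t+1)}=\{a\in A^{(t)}\setminus J^{(t)}:|N_{G^{(t)}}(a)\cap B^{(t+1)}|+\mathrm{Lap}(1/\epsilon_1)\ge(1-\eta)\tilde D(a)+\frac{6\log n}{(1-3\eta)\epsilon_1}\}$; $E^{(t+1)}=E^{(t)}\cap(A^{(t+1)}\times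 B^{(t+1)})$; sort $J^{(t)}$ by $x_a$; output the concatenation of the $J^{(t)}$ (here $C_1',C_2'$ are constants chosen depending on $\eta$). Main algorithm on $(\mathcal{U},\mathcal{S},\epsilon,\eta)$: $T=\log_{1/(1-\eta)}n$, $\mathcal{U}_T=\mathcal{U}$, $\mathcal{S}_T=\mathcal{S}$, $\epsilon_0=\epsilon/(2T)$. For $t=T,\dots,1$: $\mathcal{A}_t=\{S\in\mathcal{S}_t:(1-\eta)^{-(t-1)}-C_1\log^2 n/\epsilon_0\le|S\cap\mathcal{U}_t|+\mathrm{Lap}(1/\epsilon_0)\le(1-\eta)^{-t}+C_1\log^2 n/\epsilon_0\}$; $J_t=$ DP-MaNIS$_\eta$ with privacy parameter $\epsilon_0$ on the bipartite graph with sides $\mathcal{A}_t$, $\mathcal{U}_t$ and edges $(S,u)$ for $u\in S$; $\mathcal{U}_{t-1}=\mathcal{U}_t\setminus\bigcup_{S\in J_t}S$; $\mathcal{S}_{t-1}=\mathcal{S}_t\setminus J_t$. Output the concatenation $S^{(1)},S^{(2)},\dots$ of $J_T,\dots,J_1,\mathcal{S}_0$. Prefix optimality: for each $i$, let $g_i=\max_{T'\in\mathcal{S}}|T'\setminus\bigcup_{j=1}^{i-1}S^{(j)}|$; the ordering is $(\alpha,\beta)$-prefix optimal if there exist $\alpha_1,\alpha_2,\dots$ with $\bar\alpha_i=\frac1i\sum_{j\le i}\alpha_j\ge\alpha$ for all $i$ and $|S^{(i)}\setminus\bigcup_{j=1}^{i-1}S^{(j)}|\ge\alpha_i g_i-\beta$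 for every $i$.
   Formalization: The formal theorem assumes the number of sets is at most n^κ for a fixed but arbitrary κ, with constants allowed to depend on κ; without such a bound the claim fails, e.g. when the family consists of all subsets of the universe, ε = 1 and η is small. *)

theory Defs
  imports "HOL-Probability.Probability"
begin

definition laplace :: "real \<Rightarrow> real measure" where
  "laplace b = density lborel (\<lambda>x. ennreal (exp (- \<bar>x\<bar> / b) / (2 * b)))"

lemma prob_space_laplace:
  assumes "b > 0"
  shows "prob_space (laplace b)"
proof
  let ?e = "\<lambda>x. ennreal (exponential_density (1 / b) x)"
  interpret E: prob_space "density lborel ?e"
    using assms by (intro prob_space_exponential_density) simp
  have e1: "(\<integral>\<^sup>+x. ?e x \<partial>lborel) = 1"
    using E.emeasure_space_1 by (simp add: emeasure_density)
  have e2: "(\<integral>\<^sup>+x. ?e (- x) \<partial>lborel) = 1"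
    using nn_integral_real_affine[of ?e "-1" 0] e1 by simp
  define c :: real where "c = 1 / 2"
  have c0: "c \<ge> 0" by (simp add: c_def)
  have ae: "AE x in lborel. ennreal (exp (- \<bar>x\<bar> / b) / (2 * b)) = ennreal c * (?e x + ?e (- x))"
    using AE_lborel_singleton[of "0::real"]
  proof eventually_elim
    case (elim x)
    have "ennreal c * (?e x + ?e (- x)) =
        ennreal (c * (exponential_density (1 / b) x + exponential_density (1 / b) (- x)))"
      using assms
      by (simp add: exponential_density_nonneg ennreal_mult' c0)
    also have "c * (exponential_density (1 / b) x + exponential_density (1 / b) (- x)) =
        exp (- \<bar>x\<bar> / b) / (2 * b)"
      using elim by (auto simp: exponential_density_def c_def abs_if)
    finally show ?case by simp
  qed
  have "emeasure (laplace b) (space (laplace b)) = (\<integral>\<^sup>+x. ennreal (exp (- \<bar>x\<bar> / b) / (2 * b)) \<partial>lborel)"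
    by (simp add: laplace_def emeasure_density)
  also have "\<dots> = (\<integral>\<^sup>+x. ennreal c * (?e x + ?e (- x)) \<partial>lborel)"
    by (rule nn_integral_cong_AE[OF ae])
  also have "\<dots> = ennreal c * (1 + 1)"
    by (simp add: nn_integral_cmult nn_integral_add e1 e2)
  also have "\<dots> = 1"
    unfolding one_add_one ennreal_numeral[symmetric]
    by (subst ennreal_mult'[symmetric]) (simp_all add: c_def)
  finally show "emeasure (laplace b) (space (laplace b)) = 1" .
qed

text \<open>
  The randomness is a tape of independent draws, one coordinate per place where the algorithm
  draws; the algorithm is then a deterministic function of the tape. The first argument is the
  phase \<open>t\<close> of the main loop, the second one (if present) the round of the subroutine
  call made in that phase.
\<close>

datatype 'a draw =
    Size_Noise nat "'a set"         \<comment> \<open>noise in the definition of the active family of a phase\<close>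
  | Deg_Noise nat "'a set"          \<comment> \<open>noise in the noisy initial degree\<close>
  | Priority nat nat "'a set"       \<comment> \<open>the uniform \<open>x\<^sub>a\<close>\<close>
  | Pick_Noise nat nat "'a set"     \<comment> \<open>noise in the test for joining the output\<close>
  | Keep_Noise nat nat "'a set"     \<comment> \<open>noise in the test for staying in the graph\<close>

fun draw_law :: "real \<Rightarrow> real \<Rightarrow> 'a draw \<Rightarrow> real measure" where
  "draw_law e0 e1 (Size_Noise t S) = laplace (1 / e0)"
| "draw_law e0 e1 (Deg_Noise t S) = laplace (2 / e1)"
| "draw_law e0 e1 (Priority t r S) = uniform_measure lborel {0..1}"
| "draw_law e0 e1 (Pick_Noise t r S) = laplace (1 / e1)"
| "draw_law e0 e1 (Keep_Noise t r S) = laplace (1 / e1)"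

definition tape :: "real \<Rightarrow> real \<Rightarrow> ('a draw \<Rightarrow> real) measure" where
  "tape e0 e1 = (\<Pi>\<^sub>M d\<in>UNIV. draw_law e0 e1 d)"


section \<open>The subroutine\<close>

text \<open>
  A bipartite graph is a triple \<open>(A, B, E)\<close> with \<open>E \<subseteq> A \<times> B\<close>.
  The neighbour of \<open>b\<close> with the largest priority is undefined if \<open>b\<close> is isolated.
\<close>

definition top_nbr :: "('v \<times> 'b) set \<Rightarrow> ('v \<Rightarrow> real) \<Rightarrow> 'b \<Rightarrow> 'v option" where
  "top_nbr E x b =
     (if \<exists>a. (a, b) \<in> E then Some (ARG_MAX x a. (a, b) \<in> E) else None)"

definition manis_picked ::
  "real \<Rightarrow> ('v \<Rightarrow> real) \<Rightarrow> ('v \<Rightarrow> real) \<Rightarrow> ('v \<Rightarrow> real)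
   \<Rightarrow> 'v set \<times> 'b set \<times> ('v \<times> 'b) set \<Rightarrow> 'v set" where
  "manis_picked \<eta> deg x pick = (\<lambda>(A, B, E).
     {a \<in> A. real (card {b \<in> B. top_nbr E x b = Some a}) + pick a \<ge> (1 - 4 * \<eta>) * deg a})"

definition manis_step ::
  "real \<Rightarrow> real \<Rightarrow> real \<Rightarrow> ('v \<Rightarrow> real) \<Rightarrow> ('v \<Rightarrow> real) \<Rightarrow> ('v \<Rightarrow> real) \<Rightarrow> ('v \<Rightarrow> real)
   \<Rightarrow> 'v set \<times> 'b set \<times> ('v \<times> 'b) set \<Rightarrow> 'v set \<times> 'b set \<times> ('v \<times> 'b) set" where
  "manis_step \<eta> n e1 deg x pick keep = (\<lambda>(A, B, E).
     let J = manis_picked \<eta> deg x pick (A, B, E);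
         B' = B - E `` J;
         A' = {a \<in> A - J. real (card (E `` {a} \<inter> B')) + keep a
                \<ge> (1 - \<eta>) * deg a + 6 * ln n / ((1 - 3 * \<eta>) * e1)}
     in (A', B', E \<inter> (A' \<times> B')))"

primrec manis_graph ::
  "real \<Rightarrow> real \<Rightarrow> real \<Rightarrow> ('v \<Rightarrow> real) \<Rightarrow> (nat \<Rightarrow> 'v \<Rightarrow> real) \<Rightarrow> (nat \<Rightarrow> 'v \<Rightarrow> real)
   \<Rightarrow> (nat \<Rightarrow> 'v \<Rightarrow> real) \<Rightarrow> 'v set \<times> 'b set \<times> ('v \<times> 'b) set \<Rightarrow> nat
   \<Rightarrow> 'v set \<times> 'b set \<times> ('v \<times> 'b) set" where
  "manis_graph \<eta> n e1 deg x pick keep G 0 = G"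
| "manis_graph \<eta> n e1 deg x pick keep G (Suc r) =
     manis_step \<eta> n e1 deg (x r) (pick r) (keep r) (manis_graph \<eta> n e1 deg x pick keep G r)"

text \<open>Largest priority first; ties (a null event) are broken arbitrarily.\<close>

definition sort_by_priority :: "('v \<Rightarrow> real) \<Rightarrow> 'v set \<Rightarrow> 'v list" where
  "sort_by_priority x J =
     (SOME l. distinct l \<and> set l = J \<and> sorted_wrt (\<lambda>a b. x a \<ge> x b) l)"

text \<open>
  The noises \<open>deg_noise\<close>, \<open>pick\<close>, \<open>keep\<close> and the priorities \<open>x\<close> are arguments.
  The round index runs over the integers \<open>0, \<dots>, \<lfloor>C2' log n\<rfloor>\<close>.
\<close>

definition dp_manis ::
  "real \<Rightarrow> real \<Rightarrow> real \<Rightarrow> real \<Rightarrow> ('v \<Rightarrow> real) \<Rightarrow> (nat \<Rightarrow> 'v \<Rightarrow> real) \<Rightarrow> (nat \<Rightarrow> 'v \<Rightarrow> real)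
   \<Rightarrow> (nat \<Rightarrow> 'v \<Rightarrow> real) \<Rightarrow> 'v set \<times> 'b set \<times> ('v \<times> 'b) set \<Rightarrow> 'v list" where
  "dp_manis \<eta> C2' n e1 deg_noise x pick keep = (\<lambda>(A, B, E).
     let deg = (\<lambda>a. real (card (E `` {a})) + deg_noise a)
     in concat (map (\<lambda>r. sort_by_priority (x r)
               (manis_picked \<eta> deg (x r) (pick r)
                 (manis_graph \<eta> n e1 deg x pick keep (A, B, E) r)))
          [0..<Suc (nat \<lfloor>C2' * ln n\<rfloor>)]))"


section \<open>The main algorithm\<close>

definition eps0 :: "real \<Rightarrow> real \<Rightarrow> real \<Rightarrow> real" where
  "eps0 \<eta> n \<epsilon> = \<epsilon> / (2 * log (1 / (1 - \<eta>)) n)"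

definition eps1 :: "real \<Rightarrow> real \<Rightarrow> real \<Rightarrow> real" where
  "eps1 C1' n e = e / (C1' * ln n)"

definition active_family ::
  "real \<Rightarrow> real \<Rightarrow> real \<Rightarrow> real \<Rightarrow> ('a set \<Rightarrow> real) \<Rightarrow> nat \<Rightarrow> 'a set \<Rightarrow> 'a set set \<Rightarrow> 'a set set" where
  "active_family \<eta> C1 n e0 noise t U F =
     {S \<in> F. (1 / (1 - \<eta>)) ^ (t - 1) - C1 * (ln n)\<^sup>2 / e0 \<le> real (card (S \<inter> U)) + noise S
          \<and> real (card (S \<inter> U)) + noise S \<le> (1 / (1 - \<eta>)) ^ t + C1 * (ln n)\<^sup>2 / e0}"

text \<open>
  \<open>cover_from \<dots> t U F\<close> is the output of phases \<open>t, \<dots>, 1\<close> from \<open>\<U>\<^sub>t = U\<close>, \<open>\<S>\<^sub>t = F\<close>, followed by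
  the leftover family listed in the order \<open>rest\<close>, which the algorithm leaves open.
\<close>

primrec cover_from ::
  "real \<Rightarrow> real \<Rightarrow> real \<Rightarrow> real \<Rightarrow> real \<Rightarrow> real \<Rightarrow> ('a set set \<Rightarrow> 'a set list) \<Rightarrow> ('a draw \<Rightarrow> real)
   \<Rightarrow> nat \<Rightarrow> 'a set \<Rightarrow> 'a set set \<Rightarrow> 'a set list" where
  "cover_from \<eta> C1 C2' n e0 e1 rest \<omega> 0 = (\<lambda>U F. rest F)"
| "cover_from \<eta> C1 C2' n e0 e1 rest \<omega> (Suc t) = (\<lambda>U F.
     let A = active_family \<eta> C1 n e0 (\<lambda>S. \<omega> (Size_Noise (Suc t) S)) (Suc t) U F;
         J = dp_manis \<eta> C2' n e1
               (\<lambda>S. \<omega> (Deg_Noise (Suc t) S))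
               (\<lambda>r S. \<omega> (Priority (Suc t) r S))
               (\<lambda>r S. \<omega> (Pick_Noise (Suc t) r S))
               (\<lambda>r S. \<omega> (Keep_Noise (Suc t) r S))
               (A, U, {(S, u). S \<in> A \<and> u \<in> U \<and> u \<in> S})
     in J @ cover_from \<eta> C1 C2' n e0 e1 rest \<omega> t (U - \<Union> (set J)) (F - set J))"

text \<open>
  The number of phases is \<open>T = log\<^bsub>1/(1-\<eta>)\<^esub> n\<close> rounded up, so that the first phase covers sets
  of every size up to \<open>n\<close>; the privacy parameter \<open>\<epsilon>\<^sub>0\<close> uses the unrounded \<open>T\<close>.
\<close>

definition dp_cover ::
  "real \<Rightarrow> real \<Rightarrow> real \<Rightarrow> real \<Rightarrow> ('a set set \<Rightarrow> 'a set list) \<Rightarrow> 'a set \<Rightarrow> 'a set set \<Rightarrow> real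
   \<Rightarrow> ('a draw \<Rightarrow> real) \<Rightarrow> 'a set list" where
  "dp_cover \<eta> C1 C1' C2' rest U F \<epsilon> \<omega> =
     (let n = real (card U); e0 = eps0 \<eta> n \<epsilon>; e1 = eps1 C1' n e0
      in cover_from \<eta> C1 C2' n e0 e1 rest \<omega> (nat \<lceil>log (1 / (1 - \<eta>)) n\<rceil>) U F)"

definition dp_cover_tape :: "real \<Rightarrow> real \<Rightarrow> 'a set \<Rightarrow> real \<Rightarrow> ('a draw \<Rightarrow> real) measure" where
  "dp_cover_tape \<eta> C1' U \<epsilon> =
     (let n = real (card U); e0 = eps0 \<eta> n \<epsilon> in tape e0 (eps1 C1' n e0))"


section \<open>Prefix optimality\<close>

text \<open>Lists are indexed from 0, so \<open>L ! i\<close> is \<open>S\<^sup>(\<^sup>i\<^sup>+\<^sup>1\<^sup>)\<close>.\<close>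

definition best_gain :: "'a set set \<Rightarrow> 'a set list \<Rightarrow> nat \<Rightarrow> nat" where
  "best_gain F L i = Max ((\<lambda>S. card (S - \<Union> (set (take i L)))) ` F)"

definition prefix_optimal :: "'a set set \<Rightarrow> real \<Rightarrow> real \<Rightarrow> 'a set list \<Rightarrow> bool" where
  "prefix_optimal F \<alpha> \<beta> L \<longleftrightarrow>
     distinct L \<and> set L = F \<and>
     (\<exists>a :: nat \<Rightarrow> real. \<forall>i < length L.
        (\<Sum>j\<le>i. a j) / real (Suc i) \<ge> \<alpha> \<and>
        real (card (L ! i - \<Union> (set (take i L)))) \<ge> a i * real (best_gain F L i) - \<beta>)"

end

theory Submission
  imports Defs
begin

text \<open>
  For \<open>\<eta> \<ge> 1/5\<close> the claim is void. Otherwise all \<open>\<alpha>\<^sub>i\<close> are taken equal to \<open>1 - 5\<eta>\<close>. Except with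
  probability \<open>O(1/n\<^sup>2)\<close> every noise is at most \<open>K = O(log\<^sup>2 n/\<epsilon>\<^sub>0)\<close>. Then a set chosen in phase \<open>t\<close> gains at
  least \<open>(1 - 4\<eta>)(1 - \<eta>)\<^bsup>-(t-1)\<^esup>\<close> up to \<open>O(K)\<close>, because the \<open>b\<close> with \<open>\<phi>(b) = a\<close> are not covered
  by sets of larger priority, while every residual size is at most \<open>(1 - \<eta>)\<^bsup>-t\<^esup> + M\<close> with \<open>M = O(K)\<close>.
  This bound reproduces itself: the test for staying in the graph multiplies the residual size by
  \<open>1 - \<eta>\<close>, so the error \<open>M\<close> contracts and does not accumulate over the phases, provided that the
  subroutine empties its graph. Once \<open>(1 - \<eta>)\<^bsup>-t\<^esup> < H\<close> for some \<open>H = O(K)\<close>, all further gains are absorbed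
  by \<open>\<beta>\<close>. Before, the noise is negligible against the degrees, and each round deletes in expectation a
  fraction \<open>\<eta>\<^sup>2/128\<close> of the edges, whatever the noise: if \<open>b\<close> is among the neighbours of \<open>a\<close> of largest
  degree, then with probability at least \<open>\<eta>/(16 deg b)\<close> the priority of \<open>a\<close> exceeds
  \<open>1 - \<eta>/(8 deg b)\<close> and \<open>a\<close> wins \<open>b\<close> and almost all its other neighbours.
\<close>

text \<open>Since \<epsilon> is arbitrary, log^2 n/\<epsilon>_0 may be tiny, and then so is \<beta>.
  A bound on the residual sizes after the last phase is then too weak: the leftover family comes in
  an arbitrary order, so nothing may be left to cover. Hence the separate treatment of
  \<open>H \<le> 1\<close>, where integrality of the cardinalities turns "less than 1" into "empty".
  The loss of edges in a round is known only in expectation, while the analysis requires bounded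
  noise, an event about the whole tape. The two are reconciled without conditioning: the number of
  edges is weighted with the indicator of bounded noise, which involves no priorities, and the
  priorities of one round are integrated out first. Markov's inequality then bounds the probability
  that edges remain after all rounds. The polynomial bound on |F| makes logarithmic slack enough in
  two places: in K for the union bound over all noises, and in C2' \<ge> 128 (\<kappa> + 4)/\<eta>^2
  for the at most |F| n initial edges. The constants are fixed in the order C2' (speed of decay),
  C1' (noise scale), C1 (at least the sum of the factors of M and K), and only then H and
  \<beta>.\<close>

section \<open>Noise, priorities and resampling\<close>

text \<open>On the tail the density is dominated by a multiple of the one of scale \<open>2b\<close>.\<close>

lemma measure_laplace_tail:
  assumes b: "b > 0"
  shows "measure (laplace b) {x. s * b < \<bar>x\<bar>} \<le> 2 * exp (- s / 2)"
proof -
  interpret L: prob_space "laplace b" by (rule prob_space_laplace[OF b])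
  interpret L2: prob_space "laplace (2 * b)" by (rule prob_space_laplace) (use b in simp)
  let ?A = "{x. s * b < \<bar>x\<bar>}"
  have "emeasure (laplace b) ?A
      = (\<integral>\<^sup>+x. ennreal (exp (- \<bar>x\<bar> / b) / (2 * b)) * indicator ?A x \<partial>lborel)"
    by (simp add: laplace_def emeasure_density)
  also have "\<dots> \<le> (\<integral>\<^sup>+x. ennreal (2 * exp (- s / 2)) * ennreal (exp (- \<bar>x\<bar> / (2 * b)) / (2 * (2 * b))) \<partial>lborel)"
  proof (rule nn_integral_mono)
    fix x :: real
    have "exp (- \<bar>x\<bar> / b) / (2 * b) \<le> 2 * exp (- s / 2) * (exp (- \<bar>x\<bar> / (2 * b)) / (2 * (2 * b)))"
      if "s * b < \<bar>x\<bar>"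
    proof -
      have "s \<le> \<bar>x\<bar> / b" using that b by (simp add: field_simps)
      then have "exp (- \<bar>x\<bar> / b) \<le> exp (- s / 2 + - \<bar>x\<bar> / (2 * b))"
        using b by (simp add: field_simps)
      then have "exp (- \<bar>x\<bar> / b) / (2 * b) \<le> exp (- s / 2 + - \<bar>x\<bar> / (2 * b)) / (2 * b)"
        using b by (intro divide_right_mono) auto
      then show ?thesis using b by (simp only: exp_add) (simp add: field_simps)
    qed
    then show "ennreal (exp (- \<bar>x\<bar> / b) / (2 * b)) * indicator ?A x
        \<le> ennreal (2 * exp (- s / 2)) * ennreal (exp (- \<bar>x\<bar> / (2 * b)) / (2 * (2 * b)))"
      using b by (auto simp: indicator_def ennreal_mult[symmetric] intro!: ennreal_leI)
  qed
  also have "\<dots> = ennreal (2 * exp (- s / 2)) * emeasure (laplace (2 * b)) (space (laplace (2 * b)))"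
    by (simp add: laplace_def emeasure_density nn_integral_cmult)
  also have "\<dots> = ennreal (2 * exp (- s / 2))"
    by (simp add: L2.emeasure_space_1)
  finally show ?thesis
    by (simp add: L.emeasure_eq_measure)
qed

lemma prob_space_uniform01: "prob_space (uniform_measure lborel {0..1::real})"
  by (rule prob_space_uniform_measure) auto

lemma uniform01_upper:
  assumes "0 \<le> p" "p \<le> (1::real)"
  shows "measure (uniform_measure lborel {0..1}) {1 - p..} = p"
proof -
  have "{0..1} \<inter> {1 - p..} = {1 - p..1}" using assms by auto
  then show ?thesis using assms by (subst measure_uniform_measure) auto
qed

lemma uniform01_singleton: "AE x in uniform_measure lborel {0..1::real}. x \<noteq> c"
  using AE_lborel_singleton[of c]
  by (intro AE_uniform_measureI) (auto elim!: eventually_mono)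

section \<open>Replacing a block of coordinates by an independent copy\<close>

definition resample :: "'i set \<Rightarrow> ('i \<Rightarrow> 'b) \<Rightarrow> ('i \<Rightarrow> 'b) \<Rightarrow> 'i \<Rightarrow> 'b" where
  "resample I y \<omega> = (\<lambda>i. if i \<in> I then y i else \<omega> i)"

context product_prob_space
begin

lemma measurable_resample:
  assumes UN: "I = UNIV"
  shows "(\<lambda>(y, \<omega>). resample J y \<omega>) \<in> (PiM I M \<Otimes>\<^sub>M PiM I M) \<rightarrow>\<^sub>M PiM I M"
  unfolding resample_def UN split_beta'
  by (rule measurable_PiM_single') (auto simp: space_PiM space_pair_measure PiE_iff)

text \<open>The preimage of a cylinder over \<open>K\<close> is a product of two cylinders, over
  \<open>K \<inter> J\<close> and \<open>K - J\<close>; multiplying their measures restores the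
  product over \<open>K\<close>, and finite cylinders determine the measure.\<close>

lemma distr_resample:
  assumes UN: "I = UNIV"
  shows "distr (PiM I M \<Otimes>\<^sub>M PiM I M) (PiM I M) (\<lambda>(y, \<omega>). resample J y \<omega>) = PiM I M"
proof (rule PiM_eq)
  interpret PP: pair_prob_space "PiM I M" "PiM I M" ..
  note meas = measurable_resample[OF UN, of J]
  fix K F
  assume K: "finite K" "K \<subseteq> I" "\<And>j. j \<in> K \<Longrightarrow> F j \<in> sets (M j)"
  let ?E = "\<lambda>L. prod_emb I M L (\<Pi>\<^sub>E j\<in>L. F j)"
  have E: "?E L \<in> sets (PiM I M)" if "L \<subseteq> K" for L
    using that K by (intro sets_PiM_I) (auto intro: finite_subset)
  have "(\<lambda>(y, \<omega>). resample J y \<omega>) -` ?E K \<inter> space (PiM I M \<Otimes>\<^sub>M PiM I M)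
      = ?E (K \<inter> J) \<times> ?E (K - J)"
    unfolding UN by (auto simp: prod_emb_iff resample_def space_pair_measure space_PiM PiE_iff UN split: if_splits)
  then have "emeasure (distr (PiM I M \<Otimes>\<^sub>M PiM I M) (PiM I M) (\<lambda>(y, \<omega>). resample J y \<omega>)) (?E K)
      = emeasure (PiM I M) (?E (K \<inter> J)) * emeasure (PiM I M) (?E (K - J))"
    using E[of K] E[of "K \<inter> J"] E[of "K - J"] P.emeasure_pair_measure_Times
    by (subst emeasure_distr[OF meas]) auto
  also have "\<dots> = (\<Prod>j\<in>K \<inter> J. emeasure (M j) (F j)) * (\<Prod>j\<in>K - J. emeasure (M j) (F j))"
    using K by (subst (1 2) emeasure_PiM_emb) auto
  also have "\<dots> = (\<Prod>j\<in>K. emeasure (M j) (F j))"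
    using K by (subst prod.union_disjoint[symmetric]) (auto intro!: prod.cong)
  finally show "emeasure (distr (PiM I M \<Otimes>\<^sub>M PiM I M) (PiM I M) (\<lambda>(y, \<omega>). resample J y \<omega>)) (?E K)
      = (\<Prod>j\<in>K. emeasure (M j) (F j))" .
qed simp

text \<open>Fubini in place of conditional expectation: for fixed \<omega> the inner integral
  averages over the coordinates in \<open>J\<close> only, so whatever depends on the others is
  constant in it.\<close>

lemma nn_integral_resample:
  assumes UN: "I = UNIV" and f: "f \<in> borel_measurable (PiM I M)"
  shows "(\<integral>\<^sup>+\<omega>. f \<omega> \<partial>PiM I M) = (\<integral>\<^sup>+\<omega>. \<integral>\<^sup>+y. f (resample J y \<omega>) \<partial>PiM I M \<partial>PiM I M)"
proof -
  interpret PP: pair_prob_space "PiM I M" "PiM I M" ..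
  note meas = measurable_resample[OF UN, of J]
  have "(\<integral>\<^sup>+\<omega>. f \<omega> \<partial>PiM I M)
      = (\<integral>\<^sup>+z. f ((\<lambda>(y, \<omega>). resample J y \<omega>) z) \<partial>(PiM I M \<Otimes>\<^sub>M PiM I M))"
    by (subst distr_resample[OF UN, symmetric, of J]) (rule nn_integral_distr[OF meas], use f in simp)
  also have "\<dots> = (\<integral>\<^sup>+\<omega>. \<integral>\<^sup>+y. f (resample J y \<omega>) \<partial>PiM I M \<partial>PiM I M)"
    using PP.nn_integral_snd[OF measurable_compose[OF meas f]] by simp
  finally show ?thesis .
qed

end

text \<open>With coordinate \<open>j\<close> held fixed, a tie means that coordinate
  \<open>i\<close> hits one prescribed value, which is null for a law without atoms. Resampling
  \<open>{i}\<close> alone separates the two.\<close>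

lemma AE_neq_component:
  fixes M :: "'i \<Rightarrow> real measure"
  assumes M: "\<And>i. prob_space (M i)" and ij: "i \<noteq> j"
    and b: "sets (M i) = sets borel" "sets (M j) = sets borel"
    and null: "\<And>c. AE x in M i. x \<noteq> c"
  shows "AE \<omega> in PiM UNIV M. \<omega> i \<noteq> \<omega> j"
proof -
  interpret product_prob_space M UNIV
    by (intro product_prob_space.intro product_sigma_finite.intro product_prob_space_axioms.intro M
        prob_space_imp_sigma_finite)
  have mi: "(\<lambda>\<omega>. \<omega> i) \<in> borel_measurable (PiM UNIV M)"
    using measurable_component_singleton[of i UNIV M] b(1) measurable_cong_sets by blast
  have mj: "(\<lambda>\<omega>. \<omega> j) \<in> borel_measurable (PiM UNIV M)"
    using measurable_component_singleton[of j UNIV M] b(2) measurable_cong_sets by blast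
  have m: "{\<omega> \<in> space (PiM UNIV M). \<omega> i = \<omega> j} \<in> sets (PiM UNIV M)"
    using mi mj by measurable
  have "emeasure (PiM UNIV M) {\<omega> \<in> space (PiM UNIV M). \<omega> i = \<omega> j}
      = (\<integral>\<^sup>+\<omega>. indicator {\<omega> \<in> space (PiM UNIV M). \<omega> i = \<omega> j} \<omega> \<partial>PiM UNIV M)"
    using m by simp
  also have "\<dots> = (\<integral>\<^sup>+\<omega>. \<integral>\<^sup>+y. indicator {\<omega> \<in> space (PiM UNIV M). \<omega> i = \<omega> j} (resample {i} y \<omega>) \<partial>PiM UNIV M \<partial>PiM UNIV M)"
    by (rule nn_integral_resample[OF refl]) (use m in simp)
  also have "\<dots> = (\<integral>\<^sup>+\<omega>. 0 \<partial>PiM UNIV M)"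
  proof (rule nn_integral_cong)
    fix \<omega>
    have "AE y in PiM UNIV M. y i \<noteq> \<omega> j"
      by (rule AE_PiM_component[OF M]) (use null in auto)
    then have "(\<integral>\<^sup>+y. indicator {\<omega> \<in> space (PiM UNIV M). \<omega> i = \<omega> j} (resample {i} y \<omega>) \<partial>PiM UNIV M)
        = (\<integral>\<^sup>+y. (0::ennreal) \<partial>PiM UNIV M)"
      by (intro nn_integral_cong_AE)
         (auto elim!: eventually_mono simp: resample_def indicator_def ij[symmetric])
    then show "(\<integral>\<^sup>+y. indicator {\<omega> \<in> space (PiM UNIV M). \<omega> i = \<omega> j} (resample {i} y \<omega>) \<partial>PiM UNIV M) = (0::ennreal)"
      by simp
  qed
  finally have "emeasure (PiM UNIV M) {\<omega> \<in> space (PiM UNIV M). \<omega> i = \<omega> j} = 0" by simp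
  then show ?thesis using m by (subst AE_iff_measurable[OF m]) auto
qed

section \<open>Expected progress of one round\<close>

lemma top_nbr_eq_Some_strict:
  assumes "(a, b) \<in> E" "\<And>a'. (a', b) \<in> E \<Longrightarrow> a' \<noteq> a \<Longrightarrow> x a' < x a"
  shows "top_nbr E x b = Some a"
proof -
  have "(ARG_MAX x a. (a, b) \<in> E) = a"
    unfolding arg_max_def is_arg_max_def
  proof (rule some_equality)
    show "(a, b) \<in> E \<and> (\<nexists>y. (y, b) \<in> E \<and> x a < x y)"
      using assms less_asym by blast
  qed (use assms in blast)
  then show ?thesis using assms(1) by (auto simp: top_nbr_def)
qed

lemma ex_maximizer_finite:
  fixes d :: "'b \<Rightarrow> nat"
  assumes "finite X" "X \<noteq> {}"
  shows "\<exists>b\<in>X. \<forall>b'\<in>X. d b' \<le> d b"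
proof -
  have "Max (d ` X) \<in> d ` X" using assms by (intro Max_in) auto
  moreover have "d b' \<le> Max (d ` X)" if "b' \<in> X" for b' using assms that by (intro Max_ge) auto
  ultimately show ?thesis by force
qed

text \<open>Take \<open>b\<close> of largest \<open>d\<close> among the elements that fail the rank
  condition. All failing elements lie weakly below \<open>b\<close>, so there are fewer than
  \<open>(1 - q) * card N\<close> of them.\<close>

lemma card_top_quantile:
  fixes d :: "'b \<Rightarrow> nat" and q :: real
  assumes fin: "finite N" and q: "0 \<le> q" "q \<le> 1"
  shows "q * card N \<le> card {b \<in> N. (1 - q) * card N \<le> card {b' \<in> N. d b' \<le> d b}}"
proof -
  let ?low = "\<lambda>b. {b' \<in> N. d b' \<le> d b}"
  let ?T = "{b \<in> N. (1 - q) * card N \<le> card (?low b)}"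
  have "real (card (N - ?T)) \<le> (1 - q) * card N \<or> N - ?T = {}"
  proof (cases "N - ?T = {}")
    case False
    have fT: "finite (N - ?T)" using fin by auto
    obtain b where b: "b \<in> N - ?T" "\<forall>b'\<in>N - ?T. d b' \<le> d b"
      using ex_maximizer_finite[OF fT False, of d] by blast
    have "N - ?T \<subseteq> ?low b" using b(2) by blast
    then have "card (N - ?T) \<le> card (?low b)" using fin by (intro card_mono) auto
    then show ?thesis using b(1) by auto
  qed auto
  moreover have "card (N - ?T) = card N - card ?T" "card ?T \<le> card N"
    using fin by (auto intro!: card_Diff_subset card_mono)
  moreover have "real (card ?T) = card N" if "N - ?T = {}"
  proof -
    have "?T = N" using that by blast
    then show ?thesis by simp
  qed
  ultimately show ?thesis
  proof (cases "N - ?T = {}")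
    case True
    then show ?thesis using q \<open>N - ?T = {} \<Longrightarrow> real (card ?T) = card N\<close> by (simp add: mult_left_le_one_le)
  next
    case False
    then have "real (card N) - card ?T \<le> (1 - q) * card N"
      using \<open>real (card (N - ?T)) \<le> (1 - q) * card N \<or> N - ?T = {}\<close>
        \<open>card (N - ?T) = card N - card ?T\<close> \<open>card ?T \<le> card N\<close> by (simp add: of_nat_diff)
    then show ?thesis by (simp add: algebra_simps)
  qed
qed

text \<open>
  For each edge \<open>(a, b)\<close> with \<open>b\<close> in the top \<open>\<eta>/8\<close> quantile of the degrees of the neighbours of \<open>a\<close>, the
  event \<open>W a b\<close> forces \<open>\<phi>(b) = a\<close> and \<open>a\<close> to be picked, so that \<open>b\<close> disappears with all its edges. For fixed
  \<open>b\<close> these events are disjoint, and only pairwise independence of the priorities is needed.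
\<close>

lemma (in prob_space) manis_round:
  fixes X :: "'v \<Rightarrow> 'a \<Rightarrow> real" and E :: "('v \<times> 'b) set"
  assumes E: "finite A" "finite B" "E \<subseteq> A \<times> B" and \<eta>: "0 < \<eta>" "\<eta> \<le> 1"
    and X [measurable]: "\<And>a. a \<in> A \<Longrightarrow> X a \<in> borel_measurable M"
    and X1: "\<And>a p. a \<in> A \<Longrightarrow> 0 \<le> p \<Longrightarrow> p \<le> 1 \<Longrightarrow> prob {\<omega> \<in> space M. 1 - p \<le> X a \<omega>} = p"
    and X2: "\<And>a a' p. a \<in> A \<Longrightarrow> a' \<in> A \<Longrightarrow> a \<noteq> a' \<Longrightarrow> 0 \<le> p \<Longrightarrow> p \<le> 1 \<Longrightarrow>
      prob {\<omega> \<in> space M. 1 - p \<le> X a \<omega> \<and> 1 - p \<le> X a' \<omega>} = p * p"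
    and thr: "\<And>a. a \<in> A \<Longrightarrow> (1 - 4 * \<eta>) * deg a \<le> (1 - \<eta> / 2) * (1 - \<eta> / 8) * card (E `` {a}) + pick a"
  shows "(\<integral>\<^sup>+\<omega>. ennreal (card {e \<in> E. snd e \<notin> E `` manis_picked \<eta> deg (\<lambda>a. X a \<omega>) pick (A, B, E)}) \<partial>M)
    \<le> ennreal ((1 - \<eta>\<^sup>2 / 128) * card E)"
proof -
  have fE: "finite E" using E by (meson finite_SigmaI finite_subset)
  define N where "N a = E `` {a}" for a
  define Ni where "Ni b = E\<inverse> `` {b}" for b
  define d where "d b = card (Ni b)" for b
  \<comment> \<open>Restricting to neighbours of \<open>a\<close> of degree at most
    \<open>d b\<close> allows the single threshold \<open>1 - p b\<close> for all of them: each has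
    at most \<open>d b\<close> rivals.\<close>
  define Low where "Low a b = {b' \<in> N a. d b' \<le> d b}" for a b
  define Top where "Top = {(a, b) \<in> E. (1 - \<eta> / 8) * card (N a) \<le> card (Low a b)}"
  \<comment> \<open>Normalised so that \<open>p b * d b = \<eta> / 8\<close>, the expected number of
    neighbours of \<open>b\<close> with priority at least \<open>1 - p b\<close>.\<close>
  define p where "p b = \<eta> / 8 / d b" for b
  define bad where "bad a b \<omega> b' \<longleftrightarrow> (\<exists>a' \<in> Ni b' - {a}. 1 - p b \<le> X a' \<omega>)" for a b \<omega> b'
  define W where "W a b \<omega> \<longleftrightarrow> 1 - p b \<le> X a \<omega> \<and> \<not> bad a b \<omega> b \<and>
      card {b' \<in> Low a b. bad a b \<omega> b'} < \<eta> / 2 * card (Low a b)" for a b \<omega>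
  define J where "J \<omega> = manis_picked \<eta> deg (\<lambda>a. X a \<omega>) pick (A, B, E)" for \<omega>
  have fN: "finite (N a)" for a
    unfolding N_def using fE by (metis Image_singleton finite_Image)
  have fNi: "finite (Ni b)" "Ni b \<subseteq> A" for b
    using finite_Image[of "E\<inverse>" "{b}"] fE E unfolding Ni_def by auto
  have fLow: "finite (Low a b)" "Low a b \<subseteq> N a" for a b
    using fN by (auto simp: Low_def)
  have EA: "a \<in> A" "b \<in> B" "b \<in> Low a b" "a \<in> Ni b" "d b > 0" if "(a, b) \<in> E" for a b
    using that E fNi[of b] by (auto simp: Low_def N_def Ni_def d_def card_gt_0_iff)
  have TopE: "Top \<subseteq> E" by (auto simp: Top_def)
  then have fTop: "finite Top" using fE finite_subset by blast
  have p: "0 < p b" "p b \<le> 1" "p b * d b = \<eta> / 8" if "(a, b) \<in> E" for a b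
  proof -
    have "1 \<le> real (d b)" using EA(5)[OF that] by simp
    then show "0 < p b" "p b \<le> 1" "p b * d b = \<eta> / 8"
      using \<eta> by (auto simp: p_def field_simps)
  qed
  have top: "top_nbr E (\<lambda>a. X a \<omega>) b' = Some a"
    if "1 - p b \<le> X a \<omega>" "b' \<in> N a" "\<not> bad a b \<omega> b'" for a b b' \<omega>
  proof (rule top_nbr_eq_Some_strict)
    fix a' assume "(a', b') \<in> E" "a' \<noteq> a"
    then have "\<not> 1 - p b \<le> X a' \<omega>" using that(3) by (auto simp: bad_def Ni_def)
    then show "X a' \<omega> < X a \<omega>" using that(1) by simp
  qed (use that in \<open>simp add: N_def\<close>)
  \<comment> \<open>Two losses: less than a fraction \<eta>/2 of \<open>Low a b\<close> goes to
    rivals, and \<open>Low a b\<close> misses at most a fraction \<eta>/8 of \<open>N a\<close>.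
    Together they give the factor in \<open>thr\<close>.\<close>
  have picked: "a \<in> J \<omega>" if ab: "(a, b) \<in> Top" and W: "W a b \<omega>" for a b \<omega>
  proof -
    let ?bad = "{b' \<in> Low a b. bad a b \<omega> b'}"
    have abE: "(a, b) \<in> E" using ab TopE by auto
    have "Low a b - ?bad \<subseteq> {b \<in> B. top_nbr E (\<lambda>a. X a \<omega>) b = Some a}"
      using top[of b a \<omega>] W fLow(2)[of a b] E by (auto simp: W_def N_def)
    then have c1: "card (Low a b - ?bad) \<le> card {b \<in> B. top_nbr E (\<lambda>a. X a \<omega>) b = Some a}"
      using E by (intro card_mono) auto
    have "card (Low a b - ?bad) = card (Low a b) - card ?bad" "card ?bad \<le> card (Low a b)"
      using fLow(1)[of a b] by (auto intro!: card_Diff_subset card_mono)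
    then have "(1 - \<eta> / 2) * card (Low a b) \<le> card (Low a b - ?bad)"
      using W by (simp add: W_def of_nat_diff algebra_simps)
    moreover have "(1 - \<eta> / 2) * ((1 - \<eta> / 8) * card (N a)) \<le> (1 - \<eta> / 2) * card (Low a b)"
      using ab \<eta> by (intro mult_left_mono) (auto simp: Top_def)
    ultimately have "(1 - \<eta> / 2) * (1 - \<eta> / 8) * card (N a)
        \<le> card {b \<in> B. top_nbr E (\<lambda>a. X a \<omega>) b = Some a}"
      using c1 by (simp add: algebra_simps)
    then show ?thesis
      using thr[OF EA(1)[OF abE]] EA(1)[OF abE] by (auto simp: J_def manis_picked_def N_def)
  qed
  have bm: "Measurable.pred M (\<lambda>\<omega>. bad a b \<omega> b')" for a b b'
    unfolding bad_def
  proof (rule pred_intros_finite(4))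
    fix a' assume "a' \<in> Ni b' - {a}"
    then have [measurable]: "X a' \<in> borel_measurable M" using X fNi[of b'] by blast
    show "Measurable.pred M (\<lambda>\<omega>. 1 - p b \<le> X a' \<omega>)" by measurable
  qed (use fNi[of b'] in simp)
  have mW: "Measurable.pred M (W a b)" if "(a, b) \<in> E" for a b
  proof -
    have aA: "a \<in> A" using EA(1) that .
    have cm: "(\<lambda>\<omega>. real (card {b' \<in> Low a b. bad a b \<omega> b'})) = (\<lambda>\<omega>. \<Sum>b'\<in>Low a b. if bad a b \<omega> b' then 1 else 0)"
      using fLow(1)[of a b] by (simp add: sum.If_cases Int_def)
    have cm [measurable]: "(\<lambda>\<omega>. real (card {b' \<in> Low a b. bad a b \<omega> b'})) \<in> borel_measurable M"
      unfolding cm using bm by (intro borel_measurable_sum measurable_If) auto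
    have [measurable]: "X a \<in> borel_measurable M" using X[OF aA] .
    have "Measurable.pred M (\<lambda>\<omega>. 1 - p b \<le> X a \<omega>)" by measurable
    moreover have "Measurable.pred M (\<lambda>\<omega>. card {b' \<in> Low a b. bad a b \<omega> b'} < \<eta> / 2 * card (Low a b))"
      by measurable
    ultimately show ?thesis
      unfolding W_def by (intro pred_intros_logic bm)
  qed
  have PW: "p b / 2 \<le> prob {\<omega> \<in> space M. W a b \<omega>}" if ab: "(a, b) \<in> E" for a b
  proof -
    note aA [simp] = EA(1)[OF ab]
    have [measurable]: "X a \<in> borel_measurable M" by simp
    let ?H = "\<lambda>\<omega>. 1 - p b \<le> X a \<omega>"
    let ?c = "\<eta> / 2 * card (Low a b)"
    let ?u = "\<lambda>\<omega>. \<Sum>b'\<in>Low a b. indicator {\<omega> \<in> space M. ?H \<omega> \<and> bad a b \<omega> b'} \<omega> :: real"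
    note pb = p[OF ab]
    have cLow: "0 < card (Low a b)"
      using EA(3)[OF ab] fLow(1) card_gt_0_iff by blast
    have mQ: "{\<omega> \<in> space M. ?H \<omega> \<and> 1 - p b \<le> X a' \<omega>} \<in> events" if "a' \<in> A" for a'
    proof -
      have [measurable]: "X a' \<in> borel_measurable M" using X that .
      show ?thesis by measurable
    qed
    have mB [simp]: "{\<omega> \<in> space M. ?H \<omega> \<and> bad a b \<omega> b'} \<in> events" for b'
    proof -
      have "{\<omega> \<in> space M. ?H \<omega>} \<in> events" by measurable
      from sets.sets_Collect_conj[OF bm[of a b b', unfolded pred_def] this] show ?thesis .
    qed
    have mW' [simp]: "{\<omega> \<in> space M. W a b \<omega>} \<in> events"
      using mW[OF ab] by (simp only: pred_def)
    have mU [simp]: "{\<omega> \<in> space M. ?u \<omega> \<ge> ?c} \<in> events"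
    proof -
      have "?u \<in> borel_measurable M"
        by (intro borel_measurable_sum borel_measurable_indicator mB)
      then show ?thesis unfolding borel_measurable_iff_ge by blast
    qed
    \<comment> \<open>Union bound over the rivals of \<open>b'\<close>, at most \<open>d b\<close>
      in number; each contributes \<open>p b * p b\<close> by pairwise independence, and
      \<open>d b * p b = \<eta> / 8\<close>.\<close>
    have Pbad: "prob {\<omega> \<in> space M. ?H \<omega> \<and> bad a b \<omega> b'} \<le> \<eta> / 8 * p b" if b': "b' \<in> Low a b" for b'
    proof -
      have "prob {\<omega> \<in> space M. ?H \<omega> \<and> bad a b \<omega> b'}
          \<le> prob (\<Union>a'\<in>Ni b' - {a}. {\<omega> \<in> space M. ?H \<omega> \<and> 1 - p b \<le> X a' \<omega>})"
      proof (rule finite_measure_mono)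
        show "(\<Union>a'\<in>Ni b' - {a}. {\<omega> \<in> space M. ?H \<omega> \<and> 1 - p b \<le> X a' \<omega>}) \<in> events"
        proof (rule sets.finite_UN)
          fix a' assume "a' \<in> Ni b' - {a}"
          then show "{\<omega> \<in> space M. ?H \<omega> \<and> 1 - p b \<le> X a' \<omega>} \<in> events"
            using fNi(2)[of b'] by (intro mQ) auto
        qed (use fNi[of b'] in simp)
      qed (auto simp: bad_def)
      also have "\<dots> \<le> (\<Sum>a'\<in>Ni b' - {a}. prob {\<omega> \<in> space M. ?H \<omega> \<and> 1 - p b \<le> X a' \<omega>})"
      proof (rule finite_measure_subadditive_finite)
        show "(\<lambda>a'. {\<omega> \<in> space M. ?H \<omega> \<and> 1 - p b \<le> X a' \<omega>}) ` (Ni b' - {a}) \<subseteq> events"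
          using fNi(2)[of b'] by (intro image_subsetI mQ) auto
      qed (use fNi[of b'] in simp)
      also have "\<dots> = (\<Sum>a'\<in>Ni b' - {a}. p b * p b)"
        using fNi[of b'] pb by (intro sum.cong refl X2) auto
      also have "\<dots> = card (Ni b' - {a}) * (p b * p b)" by simp
      also have "\<dots> \<le> d b * (p b * p b)"
        using b' fNi[of b'] pb card_Diff_subset_Int[of "Ni b'" "{a}"] card_mono[of "Ni b'" "Ni b' - {a}"]
        by (intro mult_right_mono) (auto simp: Low_def d_def)
      also have "\<dots> = \<eta> / 8 * p b" using pb(3) by (simp add: algebra_simps)
      finally show ?thesis .
    qed
    \<comment> \<open>Markov: the expected number of bad elements on \<open>?H\<close> is at most
      \<open>\<eta> / 8 * p b * card (Low a b)\<close>, so the threshold \<open>?c\<close> is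
      reached with probability at most \<open>p b / 4\<close>.\<close>
    have "prob {\<omega> \<in> space M. ?u \<omega> \<ge> ?c} \<le> (\<integral>\<omega>. ?u \<omega> \<partial>M) / ?c"
    proof (rule integral_Markov_inequality_measure[where A="{}"])
      show "integrable M ?u" by (intro Bochner_Integration.integrable_sum integrable_real_indicator mB) (simp add: emeasure_eq_measure)
    qed (use \<eta> cLow in \<open>auto intro!: sum_nonneg\<close>)
    also have "(\<integral>\<omega>. ?u \<omega> \<partial>M) = (\<Sum>b'\<in>Low a b. prob {\<omega> \<in> space M. ?H \<omega> \<and> bad a b \<omega> b'})"
    proof (subst Bochner_Integration.integral_sum)
      show "integrable M (indicator {\<omega> \<in> space M. ?H \<omega> \<and> bad a b \<omega> b'} :: _ \<Rightarrow> real)" for b'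
        by (intro integrable_real_indicator mB) (simp add: emeasure_eq_measure)
    qed (simp add: Int_def conj_ac)
    also have "\<dots> \<le> (\<Sum>b'\<in>Low a b. \<eta> / 8 * p b)" by (intro sum_mono Pbad)
    finally have Pu: "prob {\<omega> \<in> space M. ?u \<omega> \<ge> ?c} \<le> p b / 4"
      using \<eta> cLow by (simp add: field_simps divide_right_mono)
    have u: "?u \<omega> = card {b' \<in> Low a b. bad a b \<omega> b'}" if "\<omega> \<in> space M" "?H \<omega>" for \<omega>
      using that fLow(1)[of a b] by (simp add: indicator_def sum.If_cases Int_def)
    \<comment> \<open>Of the mass \<open>p b\<close>, at most \<open>p b / 8\<close> is lost because
      \<open>b\<close> itself is bad and \<open>p b / 4\<close> because too many others are; more
      than half remains.\<close>
    have "p b = prob {\<omega> \<in> space M. ?H \<omega>}" using X1 pb by simp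
    also have "\<dots> \<le> prob ({\<omega> \<in> space M. W a b \<omega>} \<union> ({\<omega> \<in> space M. ?H \<omega> \<and> bad a b \<omega> b} \<union> {\<omega> \<in> space M. ?u \<omega> \<ge> ?c}))"
      by (intro finite_measure_mono sets.Un mW' mB mU) (auto simp: W_def u)
    also have "\<dots> \<le> prob {\<omega> \<in> space M. W a b \<omega>} + prob ({\<omega> \<in> space M. ?H \<omega> \<and> bad a b \<omega> b} \<union> {\<omega> \<in> space M. ?u \<omega> \<ge> ?c})"
      by (intro measure_Un_le sets.Un mW' mB mU)
    also have "\<dots> \<le> prob {\<omega> \<in> space M. W a b \<omega>} + (prob {\<omega> \<in> space M. ?H \<omega> \<and> bad a b \<omega> b} + prob {\<omega> \<in> space M. ?u \<omega> \<ge> ?c})"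
      by (intro add_left_mono measure_Un_le mB mU)
    also have "\<dots> \<le> prob {\<omega> \<in> space M. W a b \<omega>} + (\<eta> / 8 * p b + p b / 4)"
      using Pbad[OF EA(3)[OF ab]] Pu by simp
    also have "\<eta> / 8 * p b \<le> 1 / 8 * p b"
      using \<eta> pb by (intro mult_right_mono) auto
    finally show ?thesis using pb by simp
  qed
  \<comment> \<open>The subtraction is on naturals; \<open>pt'\<close> excludes truncation and so
    permits the passage to reals below.\<close>
  have pt: "card {e \<in> E. snd e \<notin> E `` J \<omega>} \<le> card E - (\<Sum>(a, b)\<in>Top. d b * of_bool (W a b \<omega>))"
    and pt': "(\<Sum>(a, b)\<in>Top. d b * of_bool (W a b \<omega>)) \<le> card E" for \<omega>
  proof -
    let ?S = "\<Sum>(a, b)\<in>Top. d b * of_bool (W a b \<omega>)"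
    define TW where "TW = {(a, b) \<in> Top. W a b \<omega>}"
    define V where "V = snd ` TW"
    have fTW: "finite TW" using fTop by (auto simp: TW_def intro: finite_subset[rotated])
    \<comment> \<open>\<open>W a b\<close> makes \<open>a\<close> the top neighbour of
      \<open>b\<close>, so each \<open>b\<close> occurs at most once and no deleted edge is counted
      twice.\<close>
    have "inj_on snd TW"
    proof (rule inj_onI)
      fix z z' assume z: "z \<in> TW" "z' \<in> TW" "snd z = snd z'"
      obtain a b a' where ab: "z = (a, b)" "z' = (a', b)" using z(3) by (metis prod.collapse)
      have "top_nbr E (\<lambda>a. X a \<omega>) b = Some a" "top_nbr E (\<lambda>a. X a \<omega>) b = Some a'"
        using z(1,2) TopE by (auto intro!: top[of b] simp: ab TW_def W_def N_def)
      then show "z = z'" by (simp add: ab)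
    qed
    moreover have "?S = (\<Sum>z\<in>TW. d (snd z))"
    proof -
      have "?S = (\<Sum>z\<in>Top. if W (fst z) (snd z) \<omega> then d (snd z) else 0)"
        by (intro sum.cong) (auto simp: split_beta)
      also have "\<dots> = (\<Sum>z\<in>TW. d (snd z))"
        using fTop by (auto simp add: sum.inter_filter[symmetric] TW_def intro!: sum.cong)
      finally show ?thesis by simp
    qed
    ultimately have "?S = (\<Sum>b\<in>V. d b)" by (simp add: V_def sum.reindex)
    also have "\<dots> = (\<Sum>b\<in>V. card (Ni b \<times> {b}))" by (simp add: d_def card_cartesian_product)
    also have "\<dots> = card (\<Union>b\<in>V. Ni b \<times> {b})"
      using fTW fNi by (subst card_UN_disjoint) (auto simp: V_def)
    also have "(\<Union>b\<in>V. Ni b \<times> {b}) = {e \<in> E. snd e \<in> V}" by (auto simp: Ni_def)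
    finally have S: "?S = card {e \<in> E. snd e \<in> V}" .
    show "?S \<le> card E" unfolding S using fE by (intro card_mono) auto
    have "V \<subseteq> E `` J \<omega>" using picked TopE by (fastforce simp: V_def TW_def)
    then have "card {e \<in> E. snd e \<notin> E `` J \<omega>} \<le> card (E - {e \<in> E. snd e \<in> V})"
      using fE by (intro card_mono) auto
    also have "\<dots> = card E - ?S" unfolding S using fE by (intro card_Diff_subset) auto
    finally show "card {e \<in> E. snd e \<notin> E `` J \<omega>} \<le> card E - ?S" .
  qed
  have cTop: "\<eta> / 8 * card E \<le> card Top"
  proof -
    have E_sum: "E = (\<Union>a\<in>A. {a} \<times> N a)" using E by (auto simp: N_def)
    have "card E = (\<Sum>a\<in>A. card (N a))"
      unfolding E_sum using E fN by (subst card_UN_disjoint) auto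
    then have "\<eta> / 8 * card E = (\<Sum>a\<in>A. \<eta> / 8 * card (N a))"
      by (simp add: sum_distrib_left)
    also have "\<dots> \<le> (\<Sum>a\<in>A. card {b \<in> N a. (1 - \<eta> / 8) * card (N a) \<le> card {b' \<in> N a. d b' \<le> d b}})"
      unfolding of_nat_sum using \<eta> fN by (intro sum_mono card_top_quantile) auto
    also have "\<dots> = card (\<Union>a\<in>A. {a} \<times> {b \<in> N a. (1 - \<eta> / 8) * card (N a) \<le> card {b' \<in> N a. d b' \<le> d b}})"
      using E fN by (subst card_UN_disjoint) auto
    also have "(\<Union>a\<in>A. {a} \<times> {b \<in> N a. (1 - \<eta> / 8) * card (N a) \<le> card {b' \<in> N a. d b' \<le> d b}}) = Top"
      using E by (auto simp: Top_def Low_def N_def)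
    finally show ?thesis .
  qed
  let ?I = "\<lambda>\<omega>. real (card E) - (\<Sum>(a, b)\<in>Top. d b * of_bool (W a b \<omega>))"
  have int: "integrable M (\<lambda>\<omega>. d b * of_bool (W a b \<omega>) :: real)" if "(a, b) \<in> Top" for a b
    using mW[of a b] that TopE by (intro integrable_const_bound[of _ "d b"]) auto
  have "(\<integral>\<omega>. ?I \<omega> \<partial>M) = card E - (\<Sum>(a, b)\<in>Top. d b * prob {\<omega> \<in> space M. W a b \<omega>})"
  proof -
    have "(\<integral>\<omega>. d b * of_bool (W a b \<omega>) \<partial>M) = d b * prob {\<omega> \<in> space M. W a b \<omega>}" for a b
    proof -
      have "(\<integral>\<omega>. of_bool (W a b \<omega>) \<partial>M) = (\<integral>\<omega>. indicator {\<omega> \<in> space M. W a b \<omega>} \<omega> \<partial>M)"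
        by (intro Bochner_Integration.integral_cong) (auto simp: indicator_def)
      also have "\<dots> = prob ({\<omega> \<in> space M. W a b \<omega>} \<inter> space M)" by simp
      also have "{\<omega> \<in> space M. W a b \<omega>} \<inter> space M = {\<omega> \<in> space M. W a b \<omega>}" by auto
      finally show ?thesis by simp
    qed
    then show ?thesis
      using int by (subst Bochner_Integration.integral_diff)
        (auto simp: prob_space split_beta intro!: Bochner_Integration.integrable_sum sum.cong)
  qed
  \<comment> \<open>Each edge of \<open>Top\<close> contributes at least
    \<open>d b * (p b / 2) = \<eta> / 16\<close> to the expected loss, whatever the degree of
    \<open>b\<close>. As \<open>Top\<close> holds a fraction \<eta>/8 of the edges, the total is the
    fraction \<eta>^2/128.\<close>
  also have "\<dots> \<le> card E - (\<Sum>(a, b)\<in>Top. \<eta> / 16)"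
  proof (intro diff_left_mono sum_mono, clarify)
    fix a b assume "(a, b) \<in> Top"
    then have ab: "(a, b) \<in> E" using TopE by auto
    have "d b * (p b / 2) \<le> d b * prob {\<omega> \<in> space M. W a b \<omega>}"
      using PW[OF ab] by (intro mult_left_mono) auto
    then show "\<eta> / 16 \<le> d b * prob {\<omega> \<in> space M. W a b \<omega>}" using p(3)[OF ab] by (simp add: algebra_simps)
  qed
  also have "\<dots> \<le> card E - \<eta> / 16 * (\<eta> / 8 * card E)"
    using cTop \<eta> mult_left_mono[OF cTop, of "\<eta> / 16"] by (simp add: split_beta algebra_simps)
  also have "\<dots> = (1 - \<eta>\<^sup>2 / 128) * card E" by (simp add: power2_eq_square algebra_simps)
  finally have int_le: "(\<integral>\<omega>. ?I \<omega> \<partial>M) \<le> (1 - \<eta>\<^sup>2 / 128) * card E" .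
  have I_nonneg: "0 \<le> ?I \<omega>" for \<omega>
    using pt'[of \<omega>] by linarith
  have "(\<integral>\<^sup>+\<omega>. ennreal (card {e \<in> E. snd e \<notin> E `` J \<omega>}) \<partial>M) \<le> (\<integral>\<^sup>+\<omega>. ennreal (?I \<omega>) \<partial>M)"
  proof (intro nn_integral_mono ennreal_leI)
    fix \<omega>
    have "real (card {e \<in> E. snd e \<notin> E `` J \<omega>}) \<le> real (card E - (\<Sum>(a, b)\<in>Top. d b * of_bool (W a b \<omega>)))"
      using pt[of \<omega>] by (simp only: of_nat_le_iff)
    also have "\<dots> = ?I \<omega>" using pt'[of \<omega>] by (rule of_nat_diff)
    finally show "real (card {e \<in> E. snd e \<notin> E `` J \<omega>}) \<le> ?I \<omega>" .
  qed
  also have "\<dots> = ennreal (\<integral>\<omega>. ?I \<omega> \<partial>M)"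
  proof (intro nn_integral_eq_integral I_nonneg AE_I2 Bochner_Integration.integrable_diff)
    have "integrable M (\<lambda>\<omega>. \<Sum>z\<in>Top. real (d (snd z) * of_bool (W (fst z) (snd z) \<omega>)))"
      by (intro Bochner_Integration.integrable_sum int) simp
    then show "integrable M (\<lambda>\<omega>. real (\<Sum>(a, b)\<in>Top. d b * of_bool (W a b \<omega>)))"
      by (simp add: split_beta)
  qed simp
  also have "\<dots> \<le> ennreal ((1 - \<eta>\<^sup>2 / 128) * card E)" using int_le by (rule ennreal_leI)
  finally show ?thesis by (simp add: J_def)
qed

section \<open>One run of the subroutine\<close>

text \<open>Finiteness guarantees that a maximizer exists; otherwise \<open>ARG_MAX\<close> would be
  an arbitrary value.\<close>

lemma top_nbr_SomeD:
  assumes "top_nbr E x b = Some a" "finite {a. (a, b) \<in> E}"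
  shows "(a, b) \<in> E" "\<And>a'. (a', b) \<in> E \<Longrightarrow> x a' \<le> x a"
proof -
  have ne: "{a. (a, b) \<in> E} \<noteq> {}" and a: "a = (ARG_MAX x a. (a, b) \<in> E)"
    using assms(1) by (auto simp: top_nbr_def split: if_splits)
  have "Max (x ` {a. (a, b) \<in> E}) \<in> x ` {a. (a, b) \<in> E}"
    using ne assms(2) by (intro Max_in) auto
  then obtain m where m: "(m, b) \<in> E" "x m = Max (x ` {a. (a, b) \<in> E})" by auto
  then have "is_arg_max x (\<lambda>a. (a, b) \<in> E) m"
    using assms(2) by (auto simp: is_arg_max_def not_less intro!: Max_ge)
  then have "is_arg_max x (\<lambda>a. (a, b) \<in> E) a"
    unfolding a arg_max_def by (rule someI)
  then show "(a, b) \<in> E" "\<And>a'. (a', b) \<in> E \<Longrightarrow> x a' \<le> x a"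
    by (auto simp: is_arg_max_def not_less)
qed

lemma sort_by_priority:
  assumes "finite J"
  shows "distinct (sort_by_priority x J)" "set (sort_by_priority x J) = J"
    "sorted_wrt (\<lambda>a b. x a \<ge> x b) (sort_by_priority x J)"
proof -
  obtain l0 where l0: "set l0 = J" "distinct l0" using finite_distinct_list[OF assms] by blast
  let ?l = "rev (sort_key x l0)"
  have "distinct ?l \<and> set ?l = J \<and> sorted_wrt (\<lambda>a b. x a \<ge> x b) ?l"
    using l0 sorted_sort_key[of x l0] by (simp add: sorted_wrt_rev sorted_map)
  then have "distinct (sort_by_priority x J) \<and> set (sort_by_priority x J) = J
      \<and> sorted_wrt (\<lambda>a b. x a \<ge> x b) (sort_by_priority x J)"
    unfolding sort_by_priority_def by (rule someI)
  then show "distinct (sort_by_priority x J)" "set (sort_by_priority x J) = J"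
    "sorted_wrt (\<lambda>a b. x a \<ge> x b) (sort_by_priority x J)" by auto
qed

text \<open>Every graph reached in a run is the full membership relation between its two sides, so
  only the sides need to be followed, and neighbourhoods are plain intersections.\<close>

definition incidence :: "'a set set \<Rightarrow> 'a set \<Rightarrow> ('a set \<times> 'a) set" where
  "incidence A B = {(S, u). S \<in> A \<and> u \<in> B \<and> u \<in> S}"

lemma incidence_Image:
  "S \<in> A \<Longrightarrow> incidence A B `` {S} = S \<inter> B"
  "J \<subseteq> A \<Longrightarrow> incidence A B `` J = B \<inter> \<Union>J"
  by (auto simp: incidence_def)

lemma finite_incidence: "finite A \<Longrightarrow> finite B \<Longrightarrow> finite (incidence A B)"
  by (rule finite_subset[of _ "A \<times> B"]) (auto simp: incidence_def)

text \<open>Prefix optimality with all coefficients equal to \<alpha>, relative to a remaining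
  universe. Quantifying over \<open>S\<close> instead of taking a maximum, and intersecting with
  \<open>U\<close>, makes it compose phase by phase.\<close>

definition greedy_on :: "'a set set \<Rightarrow> real \<Rightarrow> real \<Rightarrow> 'a set \<Rightarrow> 'a set list \<Rightarrow> bool" where
  "greedy_on F \<alpha> \<beta> U L \<longleftrightarrow> (\<forall>i<length L. \<forall>S\<in>F.
     \<alpha> * card (S \<inter> U - \<Union>(set (take i L))) - \<beta> \<le> card (L ! i \<inter> U - \<Union>(set (take i L))))"

lemma greedy_on_Nil [simp]: "greedy_on F \<alpha> \<beta> U []"
  by (simp add: greedy_on_def)

lemma greedy_on_append:
  assumes "greedy_on F \<alpha> \<beta> U L" "greedy_on F \<alpha> \<beta> (U - \<Union>(set L)) L'"
  shows "greedy_on F \<alpha> \<beta> U (L @ L')"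
  unfolding greedy_on_def
proof (intro allI impI)
  fix i assume i: "i < length (L @ L')"
  show "\<forall>S\<in>F. \<alpha> * card (S \<inter> U - \<Union>(set (take i (L @ L')))) - \<beta>
      \<le> card ((L @ L') ! i \<inter> U - \<Union>(set (take i (L @ L'))))"
  proof (cases "i < length L")
    case True
    then show ?thesis using assms(1) by (simp add: greedy_on_def nth_append)
  next
    case False
    define j where "j = i - length L"
    have j: "i = length L + j" "j < length L'" using False i by (auto simp: j_def)
    have "X \<inter> U - \<Union>(set (take i (L @ L'))) = X \<inter> (U - \<Union>(set L)) - \<Union>(set (take j L'))" for X
      by (auto simp: j)
    then show ?thesis using assms(2) j by (simp add: greedy_on_def nth_append)
  qed
qed

text \<open>The left-hand side of the inequality is at most 0, so no order of the list can violate
  it. This disposes of the late phases and of the unspecified order \<open>rest\<close>.\<close>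

lemma greedy_on_small:
  assumes "\<alpha> \<le> 1" "finite U" "\<And>S. S \<in> F \<Longrightarrow> real (card (S \<inter> U)) \<le> \<beta>"
  shows "greedy_on F \<alpha> \<beta> U L"
  unfolding greedy_on_def
proof (intro allI impI ballI)
  fix i S assume "S \<in> F"
  let ?c = "card (S \<inter> U - \<Union>(set (take i L)))"
  have "\<alpha> * ?c \<le> ?c" using assms(1) by (simp add: mult_left_le_one_le mult_right_mono[of \<alpha> 1, simplified])
  also have "\<dots> \<le> card (S \<inter> U)" using assms(2) by (auto intro!: card_mono)
  also have "\<dots> \<le> \<beta>" using assms(3) \<open>S \<in> F\<close> .
  finally show "\<alpha> * ?c - \<beta> \<le> card (L ! i \<inter> U - \<Union>(set (take i L)))" by simp
qed

section \<open>Deterministic analysis of one run of the subroutine, all draws fixed\<close>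

locale manis_run =
  fixes \<eta> n e1 :: real and deg :: "'a set \<Rightarrow> real" and x pick keep :: "nat \<Rightarrow> 'a set \<Rightarrow> real"
    and A0 :: "'a set set" and B0 :: "'a set"
  assumes fin: "finite A0" "finite B0"
begin

definition graph where
  "graph r = manis_graph \<eta> n e1 deg x pick keep (A0, B0, incidence A0 B0) r"

definition sets_at where "sets_at r = fst (graph r)"
definition elems_at where "elems_at r = fst (snd (graph r))"
definition picked_at where "picked_at r = manis_picked \<eta> deg (x r) (pick r) (graph r)"
definition out_list where "out_list k = concat (map (\<lambda>r. sort_by_priority (x r) (picked_at r)) [0..<k])"

lemma
  shows graph_eq: "graph r = (sets_at r, elems_at r, incidence (sets_at r) (elems_at r))"
    and sets_at_Suc: "sets_at (Suc r) = {a \<in> sets_at r - picked_at r.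
      card (a \<inter> elems_at (Suc r)) + keep r a \<ge> (1 - \<eta>) * deg a + 6 * ln n / ((1 - 3 * \<eta>) * e1)}"
    and elems_at_Suc: "elems_at (Suc r) = elems_at r - \<Union>(picked_at r)"
    and picked_subset: "picked_at r \<subseteq> sets_at r"
proof -
  have *: "manis_step \<eta> n e1 deg x' p k (A, B, incidence A B)
      = (let J = manis_picked \<eta> deg x' p (A, B, incidence A B); B' = B - \<Union>J;
             A' = {a \<in> A - J. card (a \<inter> B') + k a \<ge> (1 - \<eta>) * deg a + 6 * ln n / ((1 - 3 * \<eta>) * e1)}
         in (A', B', incidence A' B'))" for x' p A B and k :: "'a set \<Rightarrow> real"
  proof -
    let ?J = "manis_picked \<eta> deg x' p (A, B, incidence A B)"
    have J: "?J \<subseteq> A" by (auto simp: manis_picked_def)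
    have B': "B - incidence A B `` ?J = B - \<Union>?J" using J by (auto simp: incidence_Image)
    have I: "incidence A B \<inter> A' \<times> (B - \<Union>?J) = incidence A' (B - \<Union>?J)" if "A' \<subseteq> A" for A'
      using that by (auto simp: incidence_def)
    have C: "incidence A B `` {a} \<inter> (B - \<Union>?J) = a \<inter> (B - \<Union>?J)" if "a \<in> A - ?J" for a
      using that by (auto simp: incidence_def)
    show ?thesis
      unfolding manis_step_def Let_def prod.case B'
      by (subst I) (auto simp: C cong: conj_cong)
  qed
  show geq: "graph r = (sets_at r, elems_at r, incidence (sets_at r) (elems_at r))" for r
  proof (induction r)
    case 0
    then show ?case by (simp add: sets_at_def elems_at_def graph_def)
  next
    case (Suc r)
    have "graph (Suc r) = manis_step \<eta> n e1 deg (x r) (pick r) (keep r)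
        (sets_at r, elems_at r, incidence (sets_at r) (elems_at r))"
      by (simp add: graph_def flip: Suc.IH[unfolded graph_def])
    then obtain A' B' where "graph (Suc r) = (A', B', incidence A' B')"
      unfolding * Let_def by blast
    then show ?case by (simp add: sets_at_def elems_at_def)
  qed
  have "graph (Suc r) = manis_step \<eta> n e1 deg (x r) (pick r) (keep r)
        (sets_at r, elems_at r, incidence (sets_at r) (elems_at r))"
    by (simp add: graph_def flip: geq[unfolded graph_def])
  then have g: "graph (Suc r) = (let J = picked_at r; B' = elems_at r - \<Union>J;
             A' = {a \<in> sets_at r - J. card (a \<inter> B') + keep r a \<ge> (1 - \<eta>) * deg a + 6 * ln n / ((1 - 3 * \<eta>) * e1)}
         in (A', B', incidence A' B'))"
    by (simp add: * picked_at_def geq)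
  show "elems_at (Suc r) = elems_at r - \<Union>(picked_at r)"
    using g by (simp add: Let_def elems_at_def)
  then show "sets_at (Suc r) = {a \<in> sets_at r - picked_at r.
      card (a \<inter> elems_at (Suc r)) + keep r a \<ge> (1 - \<eta>) * deg a + 6 * ln n / ((1 - 3 * \<eta>) * e1)}"
    using g by (simp add: Let_def sets_at_def)
  show "picked_at r \<subseteq> sets_at r"
    by (auto simp: picked_at_def manis_picked_def geq)
qed

lemma at_0 [simp]: "sets_at 0 = A0" "elems_at 0 = B0"
  by (simp_all add: sets_at_def elems_at_def graph_def)

lemma sets_at_antimono: "r \<le> r' \<Longrightarrow> sets_at r' \<subseteq> sets_at r"
  by (induction rule: dec_induct) (auto simp: sets_at_Suc)

lemma elems_at_antimono: "r \<le> r' \<Longrightarrow> elems_at r' \<subseteq> elems_at r"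
  by (induction rule: dec_induct) (auto simp: elems_at_Suc)

lemma sets_at_subset: "sets_at r \<subseteq> A0"
  using sets_at_antimono[of 0 r] by simp

lemma elems_at_subset: "elems_at r \<subseteq> B0"
  using elems_at_antimono[of 0 r] by simp

lemma fin_at: "finite (sets_at r)" "finite (elems_at r)" "finite (picked_at r)"
  using sets_at_subset elems_at_subset picked_subset fin by (meson finite_subset)+

lemma picked_disjoint: "r < r' \<Longrightarrow> picked_at r \<inter> picked_at r' = {}"
  using sets_at_antimono[of "Suc r" r'] picked_subset[of r'] by (auto simp: sets_at_Suc)

lemma set_out_list: "set (out_list k) = (\<Union>r<k. picked_at r)"
  by (auto simp: out_list_def sort_by_priority fin_at)

lemma distinct_out_list: "distinct (out_list k)"
  unfolding out_list_def
proof (induction k)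
  case (Suc k)
  have "set (concat (map (\<lambda>r. sort_by_priority (x r) (picked_at r)) [0..<k])) \<inter> picked_at k = {}"
    using picked_disjoint set_out_list[of k] by (auto simp: out_list_def)
  then show ?case using Suc by (simp add: sort_by_priority fin_at)
qed simp

lemma set_out_list_subset: "set (out_list k) \<subseteq> A0"
  using picked_subset sets_at_subset by (fastforce simp: set_out_list)

lemma elems_at_eq: "elems_at k = B0 - \<Union>(set (out_list k))"
  unfolding set_out_list by (induction k) (auto simp: elems_at_Suc lessThan_Suc)

text \<open>The rival \<open>S\<close> is measured by \<open>S \<inter> B0\<close>, its residual at
  the start of the run: residuals only shrink, so one comparison of degrees serves all
  rounds.\<close>

lemma greedy_round:
  fixes \<alpha> \<beta> K :: real
  assumes inj: "inj_on (x r) A0" and \<alpha>: "0 \<le> \<alpha>"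
    and pick: "\<And>a. a \<in> A0 \<Longrightarrow> pick r a \<le> K"
    and gain: "\<And>a S. a \<in> A0 \<Longrightarrow> S \<in> F \<Longrightarrow> \<alpha> * card (S \<inter> B0) - \<beta> \<le> (1 - 4 * \<eta>) * deg a - K"
  shows "greedy_on F \<alpha> \<beta> (elems_at r) (sort_by_priority (x r) (picked_at r))"
  unfolding greedy_on_def
proof (intro allI impI ballI)
  let ?l = "sort_by_priority (x r) (picked_at r)"
  let ?E = "incidence (sets_at r) (elems_at r)"
  note l = sort_by_priority[OF fin_at(3), of "x r" r]
  fix i S assume i: "i < length ?l" and S: "S \<in> F"
  let ?T = "\<Union>(set (take i ?l))" and ?a = "?l ! i"
  have a: "?a \<in> picked_at r" using i l(2) nth_mem by blast
  then have aA: "?a \<in> A0" using picked_subset sets_at_subset by blast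
  have finE: "finite {a. (a, b) \<in> ?E}" for b
    by (rule finite_subset[OF _ fin_at(1)[of r]]) (auto simp: incidence_def)
  \<comment> \<open>A set listed before \<open>?a\<close> and containing \<open>b\<close> has at
    least the priority of \<open>?a\<close>, while \<open>?a\<close> is maximal among the neighbours
    of \<open>b\<close>. Injectivity of the priorities makes the two sets equal, against
    distinctness of the list.\<close>
  have "{b \<in> elems_at r. top_nbr ?E (x r) b = Some ?a} \<subseteq> ?a \<inter> elems_at r - ?T"
  proof safe
    fix b assume b: "b \<in> elems_at r" "top_nbr ?E (x r) b = Some ?a"
    note top = top_nbr_SomeD[OF b(2) finE]
    show "b \<in> ?a" using top(1) by (auto simp: incidence_def)
    fix a' assume a': "a' \<in> set (take i ?l)" "b \<in> a'"
    then obtain j where j: "j < i" "a' = ?l ! j"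
      using i by (auto simp: in_set_conv_nth)
    have "a' \<in> picked_at r" using a'(1) l(2) set_take_subset by fast
    then have a'A: "a' \<in> sets_at r" "a' \<in> A0" using picked_subset sets_at_subset by blast+
    have "x r ?a \<le> x r a'" using sorted_wrt_nth_less[OF l(3) j(1) i] j by simp
    moreover have "x r a' \<le> x r ?a" using top(2) a'A b a'(2) by (auto simp: incidence_def)
    ultimately have "a' = ?a" using inj a'A aA by (auto simp: inj_on_def)
    then show False using j i l(1) by (simp add: nth_eq_iff_index_eq)
  qed
  then have "card {b \<in> elems_at r. top_nbr ?E (x r) b = Some ?a} \<le> card (?a \<inter> elems_at r - ?T)"
    using fin_at(2)[of r] by (intro card_mono) auto
  moreover have "(1 - 4 * \<eta>) * deg ?a \<le> card {b \<in> elems_at r. top_nbr ?E (x r) b = Some ?a} + pick r ?a"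
    using a unfolding picked_at_def manis_picked_def graph_eq[of r] by auto
  ultimately have "(1 - 4 * \<eta>) * deg ?a - K \<le> card (?a \<inter> elems_at r - ?T)"
    using pick[OF aA] by linarith
  moreover have "\<alpha> * card (S \<inter> elems_at r - ?T) \<le> \<alpha> * card (S \<inter> B0)"
    using \<alpha> fin elems_at_subset[of r] by (intro mult_left_mono of_nat_mono card_mono) auto
  ultimately show "\<alpha> * card (S \<inter> elems_at r - ?T) - \<beta> \<le> card (?a \<inter> elems_at r - ?T)"
    using gain[OF aA S] by linarith
qed

lemma greedy_out_list:
  fixes \<alpha> \<beta> K :: real
  assumes inj: "\<And>r. r < k \<Longrightarrow> inj_on (x r) A0" and \<alpha>: "0 \<le> \<alpha>"
    and pick: "\<And>r a. r < k \<Longrightarrow> a \<in> A0 \<Longrightarrow> pick r a \<le> K"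
    and gain: "\<And>a S. a \<in> A0 \<Longrightarrow> S \<in> F \<Longrightarrow> \<alpha> * card (S \<inter> B0) - \<beta> \<le> (1 - 4 * \<eta>) * deg a - K"
  shows "greedy_on F \<alpha> \<beta> B0 (out_list k)"
  using inj pick
proof (induction k)
  case 0
  then show ?case by (simp add: out_list_def)
next
  case (Suc k)
  have "out_list (Suc k) = out_list k @ sort_by_priority (x k) (picked_at k)"
    by (simp add: out_list_def)
  moreover have "greedy_on F \<alpha> \<beta> (B0 - \<Union>(set (out_list k))) (sort_by_priority (x k) (picked_at k))"
    unfolding elems_at_eq[symmetric]
    by (rule greedy_round[where K=K]) (use Suc.prems \<alpha> gain in auto)
  ultimately show ?case using Suc by (auto intro!: greedy_on_append)
qed

text \<open>Each set leaves the graph in a definite round. If it is picked, it is fully covered;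
  otherwise it fails the keep test, and its residual at that time bounds all later ones.\<close>

lemma leftover:
  fixes K :: real
  assumes a: "a \<in> A0" "sets_at k = {}"
    and keep: "\<And>r. r < k \<Longrightarrow> - K \<le> keep r a"
  shows "a \<inter> elems_at k = {} \<or>
    card (a \<inter> elems_at k) < (1 - \<eta>) * deg a + 6 * ln n / ((1 - 3 * \<eta>) * e1) + K"
proof -
  have "\<exists>r<k. a \<in> sets_at r \<and> a \<notin> sets_at (Suc r)"
  proof (rule ccontr)
    assume *: "\<not> ?thesis"
    have "r \<le> k \<Longrightarrow> a \<in> sets_at r" for r
      using * a by (induction r) auto
    then show False using a by auto
  qed
  then obtain r where r: "r < k" "a \<in> sets_at r" "a \<notin> sets_at (Suc r)" by blast
  have sub: "elems_at k \<subseteq> elems_at (Suc r)" using r elems_at_antimono[of "Suc r" k] by auto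
  show ?thesis
  proof (cases "a \<in> picked_at r")
    case True
    then show ?thesis using sub by (auto simp: elems_at_Suc)
  next
    case False
    have "card (a \<inter> elems_at k) \<le> card (a \<inter> elems_at (Suc r))"
      using sub fin_at by (intro card_mono) auto
    moreover have "card (a \<inter> elems_at (Suc r)) + keep r a < (1 - \<eta>) * deg a + 6 * ln n / ((1 - 3 * \<eta>) * e1)"
      using r False by (auto simp: sets_at_Suc)
    ultimately show ?thesis using keep[OF r(1)] by linarith
  qed
qed

text \<open>Only the latest keep test counts: the one in round \<open>r - 1\<close> already refers
  to the elements of round \<open>r\<close>. Before round 0 there has been no test, hence
  \<open>deg0\<close>.\<close>

lemma degree_at:
  fixes K :: real
  assumes "a \<in> sets_at r" and keep: "\<And>r'. r' < r \<Longrightarrow> keep r' a \<le> K"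
    and deg0: "(1 - \<eta>) * deg a - K \<le> card (a \<inter> B0)" and thr: "0 \<le> 6 * ln n / ((1 - 3 * \<eta>) * e1)"
  shows "(1 - \<eta>) * deg a - K \<le> card (a \<inter> elems_at r)"
proof (cases r)
  case 0
  then show ?thesis using deg0 by simp
next
  case (Suc r')
  then show ?thesis using assms(1) keep[of r'] thr by (auto simp: sets_at_Suc)
qed

end

section \<open>Measurability of the output\<close>

text \<open>\<open>f\<close> factors through \<open>g\<close>: on each fibre evaluate
  \<open>f\<close> at a chosen point.\<close>

lemma simple_function_determined:
  assumes g: "simple_function M g" and det: "\<And>x y. x \<in> space M \<Longrightarrow> y \<in> space M \<Longrightarrow> g x = g y \<Longrightarrow> f x = f y"
  shows "simple_function M f"
proof -
  define h where "h v = f (SOME x. x \<in> space M \<and> g x = v)" for v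
  have "simple_function M (h \<circ> g)" using g by (rule simple_function_compose)
  moreover have "(h \<circ> g) x = f x" if "x \<in> space M" for x
  proof -
    let ?y = "SOME y. y \<in> space M \<and> g y = g x"
    have "\<exists>y. y \<in> space M \<and> g y = g x" using that by blast
    from someI_ex[OF this] have "f ?y = f x" using that by (intro det) auto
    then show ?thesis by (simp add: h_def)
  qed
  ultimately show ?thesis using simple_function_cong[of M "h \<circ> g" f] by blast
qed

lemma simple_function_Collect:
  assumes fin: "finite I" and P: "\<And>i. i \<in> I \<Longrightarrow> Measurable.pred M (P i)"
  shows "simple_function M (\<lambda>x. {i \<in> I. P i x})"
  unfolding simple_function_def
proof
  show "finite ((\<lambda>x. {i \<in> I. P i x}) ` space M)"
    by (rule finite_subset[of _ "Pow I"]) (use fin in auto)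
  show "\<forall>X\<in>(\<lambda>x. {i \<in> I. P i x}) ` space M. (\<lambda>x. {i \<in> I. P i x}) -` {X} \<inter> space M \<in> sets M"
  proof
    fix X assume "X \<in> (\<lambda>x. {i \<in> I. P i x}) ` space M"
    then have "X \<subseteq> I" by auto
    then have "(\<lambda>x. {i \<in> I. P i x}) -` {X} \<inter> space M = {x \<in> space M. \<forall>i\<in>I. P i x \<longleftrightarrow> i \<in> X}"
      by auto
    also have "\<dots> \<in> sets M"
    proof (rule sets.sets_Collect_finite_All[OF _ fin])
      fix i assume "i \<in> I"
      from P[OF this] have [measurable]: "Measurable.pred M (P i)" .
      show "{x \<in> space M. P i x \<longleftrightarrow> i \<in> X} \<in> sets M" by measurable
    qed
    finally show "(\<lambda>x. {i \<in> I. P i x}) -` {X} \<inter> space M \<in> sets M" .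
  qed
qed

text \<open>The two \<open>is_arg_max\<close> predicates are equal as functions, so the Hilbert
  choice agrees even where there are ties.\<close>

lemma top_nbr_cong:
  assumes "\<And>a a'. (a, b) \<in> E \<Longrightarrow> (a', b) \<in> E \<Longrightarrow> x a < x a' \<longleftrightarrow> x' a < x' a'"
  shows "top_nbr E x b = top_nbr E x' b"
proof -
  have "is_arg_max x (\<lambda>a. (a, b) \<in> E) = is_arg_max x' (\<lambda>a. (a, b) \<in> E)"
    using assms by (auto simp: is_arg_max_def fun_eq_iff)
  then show ?thesis by (simp add: top_nbr_def arg_max_def)
qed

lemma sort_by_priority_cong:
  assumes "\<And>a a'. a \<in> J \<Longrightarrow> a' \<in> J \<Longrightarrow> x a \<le> x a' \<longleftrightarrow> x' a \<le> x' a'"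
  shows "sort_by_priority x J = sort_by_priority x' J"
proof -
  have "(distinct l \<and> set l = J \<and> sorted_wrt (\<lambda>a b. x a \<ge> x b) l) \<longleftrightarrow>
      (distinct l \<and> set l = J \<and> sorted_wrt (\<lambda>a b. x' a \<ge> x' b) l)" for l
    using assms by (auto simp: sorted_wrt_iff_nth_less)
  then show ?thesis by (simp add: sort_by_priority_def)
qed

text \<open>The counts compared with the thresholds are integers at most \<open>card B\<close>, so
  finitely many comparisons determine the picked sets.\<close>

lemma manis_picked_cong:
  assumes E: "E \<subseteq> A \<times> B" "finite B"
    and x: "\<And>a a'. a \<in> A \<Longrightarrow> a' \<in> A \<Longrightarrow> x a \<le> x a' \<longleftrightarrow> x' a \<le> x' a'"
    and thr: "\<And>a i. a \<in> A \<Longrightarrow> i \<le> card B \<Longrightarrow>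
      (1 - 4 * \<eta>) * deg a \<le> real i + pick a \<longleftrightarrow> (1 - 4 * \<eta>) * deg' a \<le> real i + pick' a"
  shows "manis_picked \<eta> deg x pick (A, B, E) = manis_picked \<eta> deg' x' pick' (A, B, E)"
proof -
  have "top_nbr E x b = top_nbr E x' b" for b
    using E x by (intro top_nbr_cong) (auto simp: not_le[symmetric])
  moreover have "card {b \<in> B. Q b} \<le> card B" for Q using E by (intro card_mono) auto
  ultimately show ?thesis using thr by (auto simp: manis_picked_def)
qed

context manis_run
begin

text \<open>The graph entering round \<open>k\<close> reads only draws of earlier rounds. This
  serves two purposes: to see the output as a function of finitely many comparisons, and to change
  the priorities of round \<open>k\<close> without changing that graph.\<close>

lemma graph_cong:
  assumes x: "\<And>r a a'. r < k \<Longrightarrow> a \<in> A0 \<Longrightarrow> a' \<in> A0 \<Longrightarrow> x r a \<le> x r a' \<longleftrightarrow> x' r a \<le> x' r a'"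
    and pick: "\<And>r a i. r < k \<Longrightarrow> a \<in> A0 \<Longrightarrow> i \<le> card B0 \<Longrightarrow>
      (1 - 4 * \<eta>) * deg a \<le> real i + pick r a \<longleftrightarrow> (1 - 4 * \<eta>) * deg' a \<le> real i + pick' r a"
    and keep: "\<And>r a i. r < k \<Longrightarrow> a \<in> A0 \<Longrightarrow> i \<le> card B0 \<Longrightarrow>
      (1 - \<eta>) * deg a + 6 * ln n / ((1 - 3 * \<eta>) * e1) \<le> real i + keep r a \<longleftrightarrow>
      (1 - \<eta>) * deg' a + 6 * ln n / ((1 - 3 * \<eta>) * e1) \<le> real i + keep' r a"
  shows "manis_run.graph \<eta> n e1 deg' x' pick' keep' A0 B0 k = graph k"
    and "r < k \<Longrightarrow> manis_run.picked_at \<eta> n e1 deg' x' pick' keep' A0 B0 r = picked_at r"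
    and "manis_run.out_list \<eta> n e1 deg' x' pick' keep' A0 B0 k = out_list k"
proof -
  interpret m: manis_run \<eta> n e1 deg' x' pick' keep' A0 B0
    by unfold_locales (rule fin)+
  have p: "m.picked_at r = picked_at r" if "r < k" "m.graph r = graph r" for r
  proof -
    have cB: "card (elems_at r) \<le> card B0" using elems_at_subset fin by (intro card_mono)
    have A: "a \<in> sets_at r \<Longrightarrow> a \<in> A0" for a using sets_at_subset by auto
    show ?thesis
      unfolding m.picked_at_def picked_at_def that(2) unfolding graph_eq[of r]
    proof (rule manis_picked_cong[symmetric])
      show "x r a \<le> x r a' \<longleftrightarrow> x' r a \<le> x' r a'" if "a \<in> sets_at r" "a' \<in> sets_at r" for a a'
        using x[OF \<open>r < k\<close> A A] that .
      show "(1 - 4 * \<eta>) * deg a \<le> real i + pick r a \<longleftrightarrow> (1 - 4 * \<eta>) * deg' a \<le> real i + pick' r a"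
        if "a \<in> sets_at r" "i \<le> card (elems_at r)" for a i
        using pick[OF \<open>r < k\<close> A] that cB by simp
    qed (use fin_at in \<open>auto simp: incidence_def\<close>)
  qed
  have g: "r \<le> k \<Longrightarrow> m.graph r = graph r" for r
  proof (induction r)
    case 0
    then show ?case by (simp add: m.graph_def graph_def)
  next
    case (Suc r)
    then have g: "m.graph r = graph r" and r: "r < k" by auto
    have e: "m.elems_at (Suc r) = elems_at (Suc r)"
      unfolding m.elems_at_Suc elems_at_Suc p[OF r g] by (simp add: m.elems_at_def elems_at_def g)
    have "card (a \<inter> elems_at (Suc r)) \<le> card B0" for a
      using elems_at_subset[of "Suc r"] fin by (intro card_mono) auto
    then have "m.sets_at (Suc r) = sets_at (Suc r)"
      unfolding m.sets_at_Suc sets_at_Suc p[OF r g] e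
      using keep[OF r] sets_at_subset[of r] by (auto simp: m.sets_at_def sets_at_def g)
    then show ?case using e by (simp only: m.graph_eq[of "Suc r"] graph_eq[of "Suc r"])
  qed
  show "m.graph k = graph k" using g by simp
  show "r < k \<Longrightarrow> m.picked_at r = picked_at r" for r using p g by simp
  have "map (\<lambda>r. sort_by_priority (x' r) (m.picked_at r)) [0..<k]
      = map (\<lambda>r. sort_by_priority (x r) (picked_at r)) [0..<k]"
  proof (rule map_cong[OF refl])
    fix r assume "r \<in> set [0..<k]"
    then have r: "r < k" by simp
    have A: "picked_at r \<subseteq> A0" using picked_subset[of r] sets_at_subset[of r] by blast
    have "m.picked_at r = picked_at r" using p g r by simp
    moreover have "sort_by_priority (x' r) (picked_at r) = sort_by_priority (x r) (picked_at r)"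
      by (rule sort_by_priority_cong) (use A x[OF r] in blast)
    ultimately show "sort_by_priority (x' r) (m.picked_at r) = sort_by_priority (x r) (picked_at r)" by simp
  qed
  then show "m.out_list k = out_list k" by (simp only: m.out_list_def out_list_def)
qed

end

section \<open>The main loop and its intermediate states\<close>

locale dp_run =
  fixes \<eta> n e0 e1 C1 C2' :: real and rest :: "'a set set \<Rightarrow> 'a set list"
    and U :: "'a set" and F :: "'a set set" and T :: nat
  assumes finU: "finite U" and F: "F \<subseteq> Pow U"
begin

definition R where "R = nat \<lfloor>C2' * ln n\<rfloor>"

definition fam :: "('a draw \<Rightarrow> real) \<Rightarrow> nat \<Rightarrow> 'a set \<Rightarrow> 'a set set \<Rightarrow> 'a set set" where
  "fam \<omega> t U' F' = active_family \<eta> C1 n e0 (\<lambda>S. \<omega> (Size_Noise t S)) t U' F'"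

definition deg :: "('a draw \<Rightarrow> real) \<Rightarrow> nat \<Rightarrow> 'a set \<Rightarrow> 'a set set \<Rightarrow> 'a set \<Rightarrow> real" where
  "deg \<omega> t U' F' S = real (card (incidence (fam \<omega> t U' F') U' `` {S})) + \<omega> (Deg_Noise t S)"

definition gr where
  "gr \<omega> t U' F' = manis_run.graph \<eta> n e1 (deg \<omega> t U' F') (\<lambda>r S. \<omega> (Priority t r S))
     (\<lambda>r S. \<omega> (Pick_Noise t r S)) (\<lambda>r S. \<omega> (Keep_Noise t r S)) (fam \<omega> t U' F') U'"

definition phase where
  "phase \<omega> t U' F' = manis_run.out_list \<eta> n e1 (deg \<omega> t U' F') (\<lambda>r S. \<omega> (Priority t r S))
     (\<lambda>r S. \<omega> (Pick_Noise t r S)) (\<lambda>r S. \<omega> (Keep_Noise t r S)) (fam \<omega> t U' F') U' (Suc R)"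

abbreviation "cover \<equiv> cover_from \<eta> C1 C2' n e0 e1 rest"

text \<open>\<open>cover_from\<close> returns only the concatenated list; this gives access to the
  universe and family before phase \<open>T - k\<close>, with \<open>k\<close> the number of phases
  already run.\<close>

primrec state :: "('a draw \<Rightarrow> real) \<Rightarrow> nat \<Rightarrow> 'a set \<times> 'a set set" where
  "state \<omega> 0 = (U, F)"
| "state \<omega> (Suc k) = (let (U', F') = state \<omega> k; J = phase \<omega> (T - k) U' F'
     in (U' - \<Union>(set J), F' - set J))"

lemma finF: "finite F"
  using F finU by (auto intro: finite_subset)

lemma fam_subset: "fam \<omega> t U' F' \<subseteq> F'"
  by (auto simp: fam_def active_family_def)

lemma run:
  assumes "U' \<subseteq> U" "F' \<subseteq> F"
  shows "manis_run (fam \<omega> t U' F') U'"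
  using assms fam_subset[of \<omega> t U' F'] finU finF by unfold_locales (auto dest: finite_subset)

lemma deg_eq:
  "S \<in> fam \<omega> t U' F' \<Longrightarrow> deg \<omega> t U' F' S = real (card (S \<inter> U')) + \<omega> (Deg_Noise t S)"
  by (simp add: deg_def incidence_Image Int_commute)

lemma cover_Suc:
  assumes "U' \<subseteq> U" "F' \<subseteq> F"
  shows "cover \<omega> (Suc t) U' F' = phase \<omega> (Suc t) U' F' @
    cover \<omega> t (U' - \<Union>(set (phase \<omega> (Suc t) U' F'))) (F' - set (phase \<omega> (Suc t) U' F'))"
proof -
  interpret m: manis_run \<eta> n e1 "deg \<omega> (Suc t) U' F'" "\<lambda>r S. \<omega> (Priority (Suc t) r S)"
     "\<lambda>r S. \<omega> (Pick_Noise (Suc t) r S)" "\<lambda>r S. \<omega> (Keep_Noise (Suc t) r S)" "fam \<omega> (Suc t) U' F'" U'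
    using run[OF assms] .
  have "dp_manis \<eta> C2' n e1 (\<lambda>S. \<omega> (Deg_Noise (Suc t) S)) (\<lambda>r S. \<omega> (Priority (Suc t) r S))
     (\<lambda>r S. \<omega> (Pick_Noise (Suc t) r S)) (\<lambda>r S. \<omega> (Keep_Noise (Suc t) r S))
     (fam \<omega> (Suc t) U' F', U', incidence (fam \<omega> (Suc t) U' F') U') = phase \<omega> (Suc t) U' F'"
    unfolding dp_manis_def phase_def m.out_list_def m.picked_at_def m.graph_def
    by (simp add: R_def deg_def[abs_def] Let_def)
  then show ?thesis by (simp add: Let_def fam_def incidence_def)
qed

lemma phase_subset:
  assumes "U' \<subseteq> U" "F' \<subseteq> F"
  shows "set (phase \<omega> t U' F') \<subseteq> F'" "distinct (phase \<omega> t U' F')"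
proof -
  interpret m: manis_run \<eta> n e1 "deg \<omega> t U' F'" "\<lambda>r S. \<omega> (Priority t r S)"
     "\<lambda>r S. \<omega> (Pick_Noise t r S)" "\<lambda>r S. \<omega> (Keep_Noise t r S)" "fam \<omega> t U' F'" U'
    using run[OF assms] .
  show "set (phase \<omega> t U' F') \<subseteq> F'" "distinct (phase \<omega> t U' F')"
    using m.set_out_list_subset m.distinct_out_list fam_subset by (fastforce simp: phase_def)+
qed

lemma state_subset: "fst (state \<omega> k) \<subseteq> U" "snd (state \<omega> k) \<subseteq> F"
  by (induction k) (auto simp: Let_def split: prod.splits)

lemma cover_permutes:
  assumes "\<And>X. finite X \<Longrightarrow> distinct (rest X) \<and> set (rest X) = X"
  shows "U' \<subseteq> U \<Longrightarrow> F' \<subseteq> F \<Longrightarrow> distinct (cover \<omega> t U' F') \<and> set (cover \<omega> t U' F') = F'"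
proof (induction t arbitrary: U' F')
  case 0
  then show ?case using assms finF by (auto dest: finite_subset)
next
  case (Suc t)
  let ?J = "phase \<omega> (Suc t) U' F'"
  have "distinct (cover \<omega> t (U' - \<Union>(set ?J)) (F' - set ?J)) \<and>
      set (cover \<omega> t (U' - \<Union>(set ?J)) (F' - set ?J)) = F' - set ?J"
    using Suc.prems by (intro Suc.IH) auto
  then show ?case
    using phase_subset[OF Suc.prems, of \<omega> "Suc t"] by (auto simp add: cover_Suc[OF Suc.prems] simp del: cover_from.simps)
qed

text \<open>
  The output depends on the tape only through finitely many comparisons. Hence it is a simple function of
  the tape, and the event in the theorem is measurable; on a non-measurable set the measure would be \<open>0\<close>.
\<close>

definition tests where
  "tests \<omega> =
    ({z \<in> {..T} \<times> F \<times> {..card U}. case z of (t, S, i) \<Rightarrow> (1 / (1 - \<eta>)) ^ (t - 1) - C1 * (ln n)\<^sup>2 / e0 \<le> real i + \<omega> (Size_Noise t S)},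
     {z \<in> {..T} \<times> F \<times> {..card U}. case z of (t, S, i) \<Rightarrow> real i + \<omega> (Size_Noise t S) \<le> (1 / (1 - \<eta>)) ^ t + C1 * (ln n)\<^sup>2 / e0},
     {z \<in> {..T} \<times> {..R} \<times> F \<times> {..card U} \<times> {..card U}. case z of (t, r, S, i, j) \<Rightarrow>
        (1 - 4 * \<eta>) * (real j + \<omega> (Deg_Noise t S)) \<le> real i + \<omega> (Pick_Noise t r S)},
     {z \<in> {..T} \<times> {..R} \<times> F \<times> {..card U} \<times> {..card U}. case z of (t, r, S, i, j) \<Rightarrow>
        (1 - \<eta>) * (real j + \<omega> (Deg_Noise t S)) + 6 * ln n / ((1 - 3 * \<eta>) * e1) \<le> real i + \<omega> (Keep_Noise t r S)},
     {z \<in> {..T} \<times> {..R} \<times> F \<times> F. case z of (t, r, S, S') \<Rightarrow> \<omega> (Priority t r S) \<le> \<omega> (Priority t r S')})"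

lemma simple_function_tests:
  assumes "\<And>d. (\<lambda>\<omega>. \<omega> d) \<in> borel_measurable M"
  shows "simple_function M tests"
proof -
  have "Measurable.pred M (\<lambda>\<omega>. a \<le> b + \<omega> d)" "Measurable.pred M (\<lambda>\<omega>. b + \<omega> d \<le> a)"
    "Measurable.pred M (\<lambda>\<omega>. a * (b + \<omega> d) \<le> c + \<omega> d')" "Measurable.pred M (\<lambda>\<omega>. a * (b + \<omega> d) + a' \<le> c + \<omega> d')"
    "Measurable.pred M (\<lambda>\<omega>. \<omega> d \<le> \<omega> d')" for a a' b c :: real and d d' :: "'a draw"
    unfolding pred_def
    by (intro borel_measurable_le borel_measurable_add borel_measurable_times borel_measurable_const assms)+
  note m = this
  show ?thesis
    unfolding tests_def[abs_def]
    by (intro simple_function_Pair simple_function_Collect finite_cartesian_product finF finite_atMost)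
       (simp_all only: mem_Times_iff split_beta m)
qed

context
  fixes \<omega> \<omega>' :: "'a draw \<Rightarrow> real"
  assumes tests: "tests \<omega> = tests \<omega>'"
begin

lemma
  assumes "t \<le> T" "S \<in> F" "i \<le> card U"
  shows size1_cong: "(1 / (1 - \<eta>)) ^ (t - 1) - C1 * (ln n)\<^sup>2 / e0 \<le> real i + \<omega> (Size_Noise t S) \<longleftrightarrow>
      (1 / (1 - \<eta>)) ^ (t - 1) - C1 * (ln n)\<^sup>2 / e0 \<le> real i + \<omega>' (Size_Noise t S)"
    and size2_cong: "real i + \<omega> (Size_Noise t S) \<le> (1 / (1 - \<eta>)) ^ t + C1 * (ln n)\<^sup>2 / e0 \<longleftrightarrow>
      real i + \<omega>' (Size_Noise t S) \<le> (1 / (1 - \<eta>)) ^ t + C1 * (ln n)\<^sup>2 / e0"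
proof -
  have "(t, S, i) \<in> fst (tests \<omega>) \<longleftrightarrow> (t, S, i) \<in> fst (tests \<omega>')"
    "(t, S, i) \<in> fst (snd (tests \<omega>)) \<longleftrightarrow> (t, S, i) \<in> fst (snd (tests \<omega>'))" using tests by auto
  then show "(1 / (1 - \<eta>)) ^ (t - 1) - C1 * (ln n)\<^sup>2 / e0 \<le> real i + \<omega> (Size_Noise t S) \<longleftrightarrow>
      (1 / (1 - \<eta>)) ^ (t - 1) - C1 * (ln n)\<^sup>2 / e0 \<le> real i + \<omega>' (Size_Noise t S)"
    "real i + \<omega> (Size_Noise t S) \<le> (1 / (1 - \<eta>)) ^ t + C1 * (ln n)\<^sup>2 / e0 \<longleftrightarrow>
      real i + \<omega>' (Size_Noise t S) \<le> (1 / (1 - \<eta>)) ^ t + C1 * (ln n)\<^sup>2 / e0"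
    using assms by (simp_all add: tests_def)
qed

lemma
  assumes "t \<le> T" "r \<le> R" "S \<in> F" "i \<le> card U" "j \<le> card U"
  shows pick_cong: "(1 - 4 * \<eta>) * (real j + \<omega> (Deg_Noise t S)) \<le> real i + \<omega> (Pick_Noise t r S) \<longleftrightarrow>
      (1 - 4 * \<eta>) * (real j + \<omega>' (Deg_Noise t S)) \<le> real i + \<omega>' (Pick_Noise t r S)"
    and keep_cong: "(1 - \<eta>) * (real j + \<omega> (Deg_Noise t S)) + 6 * ln n / ((1 - 3 * \<eta>) * e1)
        \<le> real i + \<omega> (Keep_Noise t r S) \<longleftrightarrow>
      (1 - \<eta>) * (real j + \<omega>' (Deg_Noise t S)) + 6 * ln n / ((1 - 3 * \<eta>) * e1)
        \<le> real i + \<omega>' (Keep_Noise t r S)"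
proof -
  let ?p = "\<lambda>\<omega>. fst (snd (snd (tests \<omega>)))" and ?k = "\<lambda>\<omega>. fst (snd (snd (snd (tests \<omega>))))"
  have "(t, r, S, i, j) \<in> ?p \<omega> \<longleftrightarrow> (t, r, S, i, j) \<in> ?p \<omega>'"
    "(t, r, S, i, j) \<in> ?k \<omega> \<longleftrightarrow> (t, r, S, i, j) \<in> ?k \<omega>'" using tests by auto
  then show "(1 - 4 * \<eta>) * (real j + \<omega> (Deg_Noise t S)) \<le> real i + \<omega> (Pick_Noise t r S) \<longleftrightarrow>
      (1 - 4 * \<eta>) * (real j + \<omega>' (Deg_Noise t S)) \<le> real i + \<omega>' (Pick_Noise t r S)"
    "(1 - \<eta>) * (real j + \<omega> (Deg_Noise t S)) + 6 * ln n / ((1 - 3 * \<eta>) * e1)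
        \<le> real i + \<omega> (Keep_Noise t r S) \<longleftrightarrow>
      (1 - \<eta>) * (real j + \<omega>' (Deg_Noise t S)) + 6 * ln n / ((1 - 3 * \<eta>) * e1)
        \<le> real i + \<omega>' (Keep_Noise t r S)"
    using assms unfolding tests_def by simp_all
qed

lemma priority_cong:
  assumes "t \<le> T" "r \<le> R" "S \<in> F" "S' \<in> F"
  shows "\<omega> (Priority t r S) \<le> \<omega> (Priority t r S') \<longleftrightarrow> \<omega>' (Priority t r S) \<le> \<omega>' (Priority t r S')"
proof -
  have "(t, r, S, S') \<in> snd (snd (snd (snd (tests \<omega>)))) \<longleftrightarrow> (t, r, S, S') \<in> snd (snd (snd (snd (tests \<omega>'))))"
    using tests by auto
  then show ?thesis using assms by (simp add: tests_def)
qed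

context
  fixes t U' F'
  assumes t: "t \<le> T" and sub: "U' \<subseteq> U" "F' \<subseteq> F"
begin

lemma fam_cong: "fam \<omega> t U' F' = fam \<omega>' t U' F'"
proof -
  have "card (S \<inter> U') \<le> card U" for S using sub finU by (intro card_mono) auto
  then have "S \<in> fam \<omega> t U' F' \<longleftrightarrow> S \<in> fam \<omega>' t U' F'" for S
    using size1_cong[OF t, of S "card (S \<inter> U')"] size2_cong[OF t, of S "card (S \<inter> U')"] sub
    unfolding fam_def active_family_def by auto
  then show ?thesis by blast
qed

lemma
  assumes k: "k \<le> Suc R"
  shows gr_cong: "gr \<omega> t U' F' k = gr \<omega>' t U' F' k" and phase_cong: "phase \<omega> t U' F' = phase \<omega>' t U' F'"
proof -
  interpret m: manis_run \<eta> n e1 "deg \<omega> t U' F'" "\<lambda>r S. \<omega> (Priority t r S)"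
     "\<lambda>r S. \<omega> (Pick_Noise t r S)" "\<lambda>r S. \<omega> (Keep_Noise t r S)" "fam \<omega> t U' F'" U'
    using run[OF sub] .
  have FF: "fam \<omega> t U' F' \<subseteq> F" using fam_subset sub by blast
  have cU: "card (S \<inter> U') \<le> card U" "i \<le> card U' \<Longrightarrow> i \<le> card U" for S i
    using sub finU card_mono[of U "S \<inter> U'"] card_mono[of U U'] by auto
  have d: "deg \<omega> t U' F' S = card (S \<inter> U') + \<omega> (Deg_Noise t S)"
    "deg \<omega>' t U' F' S = card (S \<inter> U') + \<omega>' (Deg_Noise t S)" if "S \<in> fam \<omega> t U' F'" for S
    using deg_eq[OF that] deg_eq[OF that[unfolded fam_cong]] by blast+
  note c = priority_cong[OF t _ subsetD[OF FF] subsetD[OF FF]]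
    pick_cong[OF t _ subsetD[OF FF] cU(2) cU(1)] keep_cong[OF t _ subsetD[OF FF] cU(2) cU(1)]
  note g = m.graph_cong[where x'="\<lambda>r S. \<omega>' (Priority t r S)" and deg'="deg \<omega>' t U' F'"
      and pick'="\<lambda>r S. \<omega>' (Pick_Noise t r S)" and keep'="\<lambda>r S. \<omega>' (Keep_Noise t r S)"]
  have "manis_run.graph \<eta> n e1 (deg \<omega>' t U' F') (\<lambda>r S. \<omega>' (Priority t r S))
     (\<lambda>r S. \<omega>' (Pick_Noise t r S)) (\<lambda>r S. \<omega>' (Keep_Noise t r S)) (fam \<omega> t U' F') U' k = m.graph k"
    using k by (intro g(1)) (simp_all add: c d)
  then show "gr \<omega> t U' F' k = gr \<omega>' t U' F' k" by (simp add: gr_def fam_cong)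
  have "manis_run.out_list \<eta> n e1 (deg \<omega>' t U' F') (\<lambda>r S. \<omega>' (Priority t r S))
     (\<lambda>r S. \<omega>' (Pick_Noise t r S)) (\<lambda>r S. \<omega>' (Keep_Noise t r S)) (fam \<omega> t U' F') U' (Suc R) = m.out_list (Suc R)"
    by (intro g(3)) (simp_all add: c d)
  then show "phase \<omega> t U' F' = phase \<omega>' t U' F'" by (simp add: phase_def fam_cong)
qed

end

lemma state_cong: "state \<omega> k = state \<omega>' k"
proof (induction k)
  case (Suc k)
  have "phase \<omega> (T - k) (fst (state \<omega> k)) (snd (state \<omega> k)) = phase \<omega>' (T - k) (fst (state \<omega> k)) (snd (state \<omega> k))"
    by (rule phase_cong[where k=0]) (use state_subset in auto)
  then show ?case using Suc by (simp add: split_beta Let_def)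
qed simp

lemma cover_cong: "t \<le> T \<Longrightarrow> U' \<subseteq> U \<Longrightarrow> F' \<subseteq> F \<Longrightarrow> cover \<omega> t U' F' = cover \<omega>' t U' F'"
proof (induction t arbitrary: U' F')
  case (Suc t)
  let ?J = "phase \<omega> (Suc t) U' F'"
  have J: "?J = phase \<omega>' (Suc t) U' F'" by (rule phase_cong[where k=0]) (use Suc.prems in auto)
  have "cover \<omega> t (U' - \<Union>(set ?J)) (F' - set ?J) = cover \<omega>' t (U' - \<Union>(set ?J)) (F' - set ?J)"
    using Suc.prems by (intro Suc.IH) auto
  then show ?case unfolding cover_Suc[OF Suc.prems(2,3)] J by simp
qed simp

end

lemma
  assumes "\<And>d. (\<lambda>\<omega>. \<omega> d) \<in> borel_measurable M"
  shows simple_function_cover: "simple_function M (\<lambda>\<omega>. cover \<omega> T U F)"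
    and simple_function_gr: "k < T \<Longrightarrow> r \<le> Suc R \<Longrightarrow>
      simple_function M (\<lambda>\<omega>. gr \<omega> (T - k) (fst (state \<omega> k)) (snd (state \<omega> k)) r)"
proof -
  show "simple_function M (\<lambda>\<omega>. cover \<omega> T U F)"
    by (rule simple_function_determined[OF simple_function_tests[OF assms]], rule cover_cong) auto
  assume "k < T" and r: "r \<le> Suc R"
  show "simple_function M (\<lambda>\<omega>. gr \<omega> (T - k) (fst (state \<omega> k)) (snd (state \<omega> k)) r)"
  proof (rule simple_function_determined[OF simple_function_tests[OF assms]])
    fix \<omega> \<omega>' :: "'a draw \<Rightarrow> real" assume t: "tests \<omega> = tests \<omega>'"
    show "gr \<omega> (T - k) (fst (state \<omega> k)) (snd (state \<omega> k)) r = gr \<omega>' (T - k) (fst (state \<omega>' k)) (snd (state \<omega>' k)) r"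
      unfolding state_cong[OF t] by (rule gr_cong[OF t _ state_subset r]) simp
  qed
qed

end

section \<open>The phases under bounded noise\<close>

text \<open>
  \<open>K\<close> bounds the noise and \<open>M\<close> the excess of residual sizes over \<open>(1 - \<eta>)\<^bsup>-t\<^esup>\<close>; phases with
  \<open>(1 - \<eta>)\<^bsup>-t\<^esup> < H\<close> are absorbed by \<open>\<beta>\<close>. If \<open>H \<le> 1\<close> there is no such phase, and the assumptions for this
  case make the residual sizes after the last phase smaller than \<open>1\<close>, hence \<open>0\<close>.
\<close>

locale dp_bounds = dp_run +
  fixes K M H \<beta> :: real
  assumes \<eta>: "0 < \<eta>" "\<eta> < 1 / 5"
    and K: "0 < K"
    and M: "2 * K + 6 * ln n / ((1 - 3 * \<eta>) * e1) \<le> \<eta> * M"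
    and thr: "0 \<le> 6 * ln n / ((1 - 3 * \<eta>) * e1)"
    and C1: "M + K \<le> C1 * (ln n)\<^sup>2 / e0"
    and H: "K / \<eta> + C1 * (ln n)\<^sup>2 / e0 + 2 * K \<le> (1 - \<eta>) * H"
    and H1: "H \<le> 1 \<Longrightarrow> 1 / (1 - \<eta>) + M < 2"
      "H \<le> 1 \<Longrightarrow> (1 - \<eta>) * (1 + K) + 6 * ln n / ((1 - 3 * \<eta>) * e1) + K < 1"
    and \<beta>: "M + C1 * (ln n)\<^sup>2 / e0 + 3 * K \<le> \<beta>" "H + M \<le> \<beta>"
    and T: "card U \<le> (1 / (1 - \<eta>)) ^ T"
begin

abbreviation "q \<equiv> 1 / (1 - \<eta>)"

definition quiet :: "('a draw \<Rightarrow> real) \<Rightarrow> bool" where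
  "quiet \<omega> \<longleftrightarrow> (\<forall>t\<in>{1..T}. \<forall>S\<in>F. \<bar>\<omega> (Size_Noise t S)\<bar> \<le> K \<and> \<bar>\<omega> (Deg_Noise t S)\<bar> \<le> K \<and>
     (\<forall>r\<le>R. \<bar>\<omega> (Pick_Noise t r S)\<bar> \<le> K \<and> \<bar>\<omega> (Keep_Noise t r S)\<bar> \<le> K))"

definition untied :: "('a draw \<Rightarrow> real) \<Rightarrow> bool" where
  "untied \<omega> \<longleftrightarrow> (\<forall>t\<in>{1..T}. \<forall>r\<le>R. inj_on (\<lambda>S. \<omega> (Priority t r S)) F)"

lemma M_pos: "0 < M"
  using M thr K \<eta> by (smt (verit) zero_less_mult_pos)

lemma q_pow: "1 \<le> t \<Longrightarrow> q ^ (t - 1) = (1 - \<eta>) * q ^ t"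
  using \<eta> by (cases t) auto

lemma q_pow_ge: "1 \<le> q ^ t"
  using \<eta> by (intro one_le_power) (simp add: field_simps)

context
  fixes \<omega> t U' F'
  assumes quiet: "quiet \<omega>" and t: "1 \<le> t" "t \<le> T" and sub: "U' \<subseteq> U" "F' \<subseteq> F"
begin

interpretation m: manis_run \<eta> n e1 "deg \<omega> t U' F'" "\<lambda>r S. \<omega> (Priority t r S)"
     "\<lambda>r S. \<omega> (Pick_Noise t r S)" "\<lambda>r S. \<omega> (Keep_Noise t r S)" "fam \<omega> t U' F'" U'
  by (rule run[OF sub])

lemma fam_F: "S \<in> fam \<omega> t U' F' \<Longrightarrow> S \<in> F"
  using fam_subset sub by blast

lemma noise:
  assumes "S \<in> F"
  shows "\<bar>\<omega> (Size_Noise t S)\<bar> \<le> K" "\<bar>\<omega> (Deg_Noise t S)\<bar> \<le> K"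
    "r \<le> R \<Longrightarrow> \<bar>\<omega> (Pick_Noise t r S)\<bar> \<le> K" "r \<le> R \<Longrightarrow> \<bar>\<omega> (Keep_Noise t r S)\<bar> \<le> K"
  using quiet t assms by (auto simp: quiet_def)

lemma deg_lower:
  assumes "S \<in> fam \<omega> t U' F'"
  shows "q ^ (t - 1) - C1 * (ln n)\<^sup>2 / e0 - 2 * K \<le> deg \<omega> t U' F' S"
    "card (S \<inter> U') - K \<le> deg \<omega> t U' F' S" "deg \<omega> t U' F' S \<le> card (S \<inter> U') + K"
proof -
  have "q ^ (t - 1) - C1 * (ln n)\<^sup>2 / e0 \<le> card (S \<inter> U') + \<omega> (Size_Noise t S)"
    using assms by (simp add: fam_def active_family_def)
  then show "q ^ (t - 1) - C1 * (ln n)\<^sup>2 / e0 - 2 * K \<le> deg \<omega> t U' F' S"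
    "card (S \<inter> U') - K \<le> deg \<omega> t U' F' S" "deg \<omega> t U' F' S \<le> card (S \<inter> U') + K"
    using noise(1,2)[OF fam_F[OF assms]] by (auto simp: deg_eq[OF assms])
qed

text \<open>In a large phase \<open>K\<close> is at most an \<eta>-fraction of the noisy degree.
  Survival leaves at least \<open>(1 - \<eta>) * deg - K\<close> elements, and the gap between
  \<open>1 - 2 * \<eta>\<close> and \<open>1 - 4 * \<eta>\<close> absorbs the noise of both tests.
  The first claim is the hypothesis \<open>thr\<close> of \<open>manis_round\<close>; by the second,
  no surviving set is isolated.\<close>

lemma deg_large:
  assumes "S \<in> m.sets_at r" "r \<le> R" and large: "H \<le> q ^ t"
  shows "(1 - 4 * \<eta>) * deg \<omega> t U' F' S
      \<le> (1 - \<eta> / 2) * (1 - \<eta> / 8) * card (S \<inter> m.elems_at r) + \<omega> (Pick_Noise t r S)"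
    and "S \<inter> m.elems_at r \<noteq> {}"
proof -
  let ?D = "deg \<omega> t U' F' S" and ?c = "real (card (S \<inter> m.elems_at r))" and ?g = "(1 - \<eta> / 2) * (1 - \<eta> / 8)"
  have S: "S \<in> fam \<omega> t U' F'" using assms(1) m.sets_at_subset by blast
  note SF = fam_F[OF S]
  have "(1 - \<eta>) * H \<le> (1 - \<eta>) * q ^ t" using large \<eta> by (intro mult_left_mono) auto
  \<comment> \<open>The membership test bounds the degree below by
    \<open>q ^ (t - 1) = (1 - \<eta>) * q ^ t\<close> minus errors, and \<open>H\<close> is large
    enough to leave \<open>K / \<eta>\<close>.\<close>
  then have D: "K / \<eta> \<le> ?D" using deg_lower(1)[OF S] H q_pow[OF t(1)] by linarith
  then have D0: "0 \<le> ?D" "K \<le> \<eta> * ?D" using K \<eta> by (auto simp: field_simps intro: order_trans[of 0 "K / \<eta>"])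
  have c: "(1 - \<eta>) * ?D - K \<le> ?c"
  proof (rule m.degree_at[OF assms(1) _ _ thr])
    show "\<omega> (Keep_Noise t r' S) \<le> K" if "r' < r" for r'
      using noise(4)[OF SF, of r'] that assms(2) by auto
    have "(1 - \<eta>) * ?D \<le> ?D" using D0 \<eta> by (intro mult_left_le_one_le) auto
    then show "(1 - \<eta>) * ?D - K \<le> card (S \<inter> U')" using deg_lower(3)[OF S] by linarith
  qed
  have g: "0 \<le> ?g" "?g \<le> 1" using \<eta> by (auto intro!: mult_le_one)
  have "1 - 2 * \<eta> \<le> ?g * (1 - \<eta>)"
  proof -
    have "?g * (1 - \<eta>) = 1 - 2 * \<eta> + \<eta> * (3 / 8 + 11 / 16 * \<eta> - \<eta>\<^sup>2 / 16)"
      by (simp add: field_simps power2_eq_square)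
    moreover have "\<eta>\<^sup>2 \<le> 1" using \<eta> by (intro power_le_one) auto
    then have "0 \<le> \<eta> * (3 / 8 + 11 / 16 * \<eta> - \<eta>\<^sup>2 / 16)"
      using \<eta> by (intro mult_nonneg_nonneg) auto
    ultimately show ?thesis by simp
  qed
  then have "(1 - 2 * \<eta>) * ?D \<le> ?g * (1 - \<eta>) * ?D" using D0 by (intro mult_right_mono)
  moreover have "?g * ((1 - \<eta>) * ?D - K) \<le> ?g * ?c" using c g by (intro mult_left_mono)
  moreover have "?g * K \<le> K" using g K by (intro mult_left_le_one_le) auto
  moreover have "- K \<le> \<omega> (Pick_Noise t r S)" using noise(3)[OF SF assms(2)] by auto
  moreover have split: "(1 - 4 * \<eta>) * ?D = (1 - 2 * \<eta>) * ?D - 2 * (\<eta> * ?D)"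
    "?g * ((1 - \<eta>) * ?D - K) = ?g * (1 - \<eta>) * ?D - ?g * K"
    by (simp_all add: field_simps)
  ultimately show "(1 - 4 * \<eta>) * ?D \<le> ?g * ?c + \<omega> (Pick_Noise t r S)"
    using D0(2) split by linarith
  have "(1 - \<eta>) * (K / \<eta>) \<le> (1 - \<eta>) * ?D" using D \<eta> by (intro mult_left_mono) auto
  moreover have "K < (1 - \<eta>) * (K / \<eta>)" using K \<eta> by (simp add: field_simps)
  ultimately have "0 < ?c" using c by linarith
  then show "S \<inter> m.elems_at r \<noteq> {}" by auto
qed

context
  assumes inv: "\<And>S. S \<in> F \<Longrightarrow> card (S \<inter> U') \<le> q ^ t + M"
    "\<And>S. S \<in> F - F' \<Longrightarrow> S \<inter> U' = {}"
begin

text \<open>\<open>1 - 5 * \<eta> \<le> (1 - 4 * \<eta>) * (1 - \<eta>)\<close>, and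
  \<open>1 - \<eta>\<close> is the ratio of the two size limits of a phase. The additive losses are
  \<open>M\<close> for the rival, the slack of the family plus \<open>2 * K\<close> for the degree,
  and \<open>K\<close> for the pick noise: the first bound on \<beta>.\<close>

lemma phase_greedy:
  assumes "untied \<omega>"
  shows "greedy_on F (1 - 5 * \<eta>) \<beta> U' (phase \<omega> t U' F')"
  unfolding phase_def
proof (rule m.greedy_out_list[where K=K])
  fix r assume r: "r < Suc R"
  have "inj_on (\<lambda>S. \<omega> (Priority t r S)) F" using assms t r by (auto simp: untied_def)
  then show "inj_on (\<lambda>S. \<omega> (Priority t r S)) (fam \<omega> t U' F')"
    by (rule inj_on_subset) (use fam_F in auto)
  show "\<omega> (Pick_Noise t r a) \<le> K" if "a \<in> fam \<omega> t U' F'" for a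
    using noise(3)[OF fam_F[OF that], of r] r by auto
next
  fix a S assume a: "a \<in> fam \<omega> t U' F'" and S: "S \<in> F"
  let ?B = "C1 * (ln n)\<^sup>2 / e0"
  have B: "0 \<le> ?B + 2 * K" using C1 M_pos K by linarith
  have "(1 - 5 * \<eta>) * card (S \<inter> U') \<le> (1 - 5 * \<eta>) * (q ^ t + M)"
    using inv(1)[OF S] \<eta> by (intro mult_left_mono) auto
  also have "\<dots> \<le> (1 - 5 * \<eta>) * q ^ t + M"
    using M_pos \<eta> by (simp add: algebra_simps)
  also have "(1 - 5 * \<eta>) * q ^ t \<le> ((1 - 4 * \<eta>) * (1 - \<eta>)) * q ^ t"
    using \<eta> by (intro mult_right_mono) (auto simp: algebra_simps)
  also have "\<dots> = (1 - 4 * \<eta>) * q ^ (t - 1)" using q_pow[OF t(1)] by simp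
  finally have "(1 - 5 * \<eta>) * card (S \<inter> U') \<le> (1 - 4 * \<eta>) * q ^ (t - 1) + M" by simp
  moreover have "(1 - 4 * \<eta>) * (q ^ (t - 1) - (?B + 2 * K)) \<le> (1 - 4 * \<eta>) * deg \<omega> t U' F' a"
    using deg_lower(1)[OF a] \<eta> by (intro mult_left_mono) auto
  moreover have "(1 - 4 * \<eta>) * (?B + 2 * K) \<le> ?B + 2 * K"
    using B \<eta> by (intro mult_left_le_one_le) auto
  ultimately show "(1 - 5 * \<eta>) * card (S \<inter> U') - \<beta> \<le> (1 - 4 * \<eta>) * deg \<omega> t U' F' a - K"
    using \<beta>(1) by (simp only: right_diff_distrib)
qed (use \<eta> in simp)

text \<open>There are three kinds of sets: the active ones, which have left the emptied graph; the
  inactive ones, which were already below the lower limit of the phase; and those output earlier,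
  which have nothing left.\<close>

lemma phase_residual:
  assumes emptied: "m.sets_at R = {}" and S: "S \<in> F"
  shows "card (S \<inter> (U' - \<Union>(set (phase \<omega> t U' F')))) \<le> q ^ (t - 1) + M"
    and "t = 1 \<Longrightarrow> H \<le> 1 \<Longrightarrow> S \<inter> (U' - \<Union>(set (phase \<omega> t U' F'))) = {}"
proof -
  let ?th = "6 * ln n / ((1 - 3 * \<eta>) * e1)"
  let ?V = "U' - \<Union>(set (phase \<omega> t U' F'))"
  \<comment> \<open>Rounds 0 to \<open>R\<close> are run, but the graph is supposed empty already on
    entering round \<open>R\<close>; the last round can only remove more elements.\<close>
  have V: "?V = m.elems_at (Suc R)" by (simp add: m.elems_at_eq phase_def)
  have finS: "finite (S \<inter> U')" using m.fin by simp
  have cV: "card (S \<inter> ?V) \<le> card (S \<inter> U')" using finS by (intro card_mono) auto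
  have "S \<inter> ?V = {} \<or> card (S \<inter> U') < q ^ (t - 1) \<or>
      card (S \<inter> ?V) < (1 - \<eta>) * (card (S \<inter> U') + K) + ?th + K"
  proof (cases "S \<in> fam \<omega> t U' F'")
    case True
    have "S \<inter> m.elems_at R = {} \<or> card (S \<inter> m.elems_at R) < (1 - \<eta>) * deg \<omega> t U' F' S + ?th + K"
    proof (rule m.leftover[OF True emptied])
      show "- K \<le> \<omega> (Keep_Noise t r S)" if "r < R" for r using noise(4)[OF S, of r] that by auto
    qed
    moreover have "card (S \<inter> ?V) \<le> card (S \<inter> m.elems_at R)" "?V \<subseteq> m.elems_at R"
      unfolding V using m.elems_at_antimono[of R "Suc R"] m.fin_at by (auto intro!: card_mono)
    moreover have "(1 - \<eta>) * deg \<omega> t U' F' S \<le> (1 - \<eta>) * (card (S \<inter> U') + K)"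
      using deg_lower(3)[OF True] \<eta> by (intro mult_left_mono) auto
    ultimately show ?thesis by (auto intro: order_le_less_trans less_le_trans)
  next
    case False
    show ?thesis
    proof (cases "S \<in> F'")
      case True
      \<comment> \<open>The upper membership test cannot fail, by the invariant and the choice of
        \<open>C1\<close>; so the lower one does.\<close>
      have "card (S \<inter> U') + \<omega> (Size_Noise t S) \<le> q ^ t + C1 * (ln n)\<^sup>2 / e0"
        using inv(1)[OF S] noise(1)[OF S] C1 by linarith
      then have "card (S \<inter> U') + \<omega> (Size_Noise t S) < q ^ (t - 1) - C1 * (ln n)\<^sup>2 / e0"
        using False True by (auto simp: fam_def active_family_def not_le)
      then show ?thesis using noise(1)[OF S] C1 M_pos by linarith
    qed (use inv(2) S in auto)
  qed
  note cases = this
  \<comment> \<open>The old excess enters with factor \<open>1 - \<eta>\<close>, and the new errors,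
    at most \<open>2 * K\<close> plus the threshold term, fit into
    \<open>\<eta> * M\<close>.\<close>
  have *: "(1 - \<eta>) * (card (S \<inter> U') + K) + ?th + K \<le> q ^ (t - 1) + M"
  proof -
    have "(1 - \<eta>) * (card (S \<inter> U') + K) \<le> (1 - \<eta>) * (q ^ t + M + K)"
      using inv(1)[OF S] \<eta> by (intro mult_left_mono) auto
    also have "\<dots> = q ^ (t - 1) + (1 - \<eta>) * M + (1 - \<eta>) * K"
      by (simp only: q_pow[OF t(1)] distrib_left)
    also have "(1 - \<eta>) * K \<le> K" using K \<eta> by (intro mult_left_le_one_le) auto
    finally show ?thesis using M by (simp add: algebra_simps)
  qed
  then show "card (S \<inter> ?V) \<le> q ^ (t - 1) + M"
    using cases cV M_pos q_pow_ge[of "t - 1"] by (elim disjE) (simp, linarith, linarith)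
  \<comment> \<open>Before this last phase at most one element of \<open>S\<close> is left, by
    integrality; afterwards each alternative forces fewer than one.\<close>
  assume t1: "t = 1" and H: "H \<le> 1"
  have "real (card (S \<inter> U')) < 2" using inv(1)[OF S] H1(1)[OF H] t1 by simp
  then have c1: "card (S \<inter> U') \<le> 1" by simp
  have "card (S \<inter> ?V) < 1" if "S \<inter> ?V \<noteq> {}"
  proof -
    have "(1 - \<eta>) * (card (S \<inter> U') + K) \<le> (1 - \<eta>) * (1 + K)"
      using c1 \<eta> by (intro mult_left_mono) auto
    then show ?thesis using cases cV t1 that H1(2)[OF H] by simp linarith
  qed
  moreover have "finite (S \<inter> ?V)" by (rule finite_subset[OF _ finS]) auto
  ultimately show "S \<inter> ?V = {}" by (metis card_eq_0_iff less_one)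
qed

end

end

definition emptied :: "('a draw \<Rightarrow> real) \<Rightarrow> nat \<Rightarrow> bool" where
  "emptied \<omega> k \<longleftrightarrow> fst (gr \<omega> (T - k) (fst (state \<omega> k)) (snd (state \<omega> k)) R) = {}"

text \<open>Induction on the number \<open>T - k\<close> of phases still to run, along the invariant
  on residual sizes. It stops at the first small phase, where everything that follows is absorbed by
  \<beta>; hence \<open>emptied\<close> is demanded of large phases only, for which it can be shown
  to be likely.\<close>

lemma greedy_cover:
  assumes quiet: "quiet \<omega>" and untied: "untied \<omega>" and emptied: "\<And>k. k < T \<Longrightarrow> H \<le> q ^ (T - k) \<Longrightarrow> emptied \<omega> k"
    and T0: "0 < T"
  shows "greedy_on F (1 - 5 * \<eta>) \<beta> U (cover \<omega> T U F)"
proof -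
  have "greedy_on F (1 - 5 * \<eta>) \<beta> (fst (state \<omega> k)) (cover \<omega> (T - k) (fst (state \<omega> k)) (snd (state \<omega> k)))"
    if "k \<le> T" "\<And>S. S \<in> F \<Longrightarrow> card (S \<inter> fst (state \<omega> k)) \<le> q ^ (T - k) + M"
      "\<And>S. S \<in> F - snd (state \<omega> k) \<Longrightarrow> S \<inter> fst (state \<omega> k) = {}"
      "\<And>S. k = T \<Longrightarrow> H \<le> 1 \<Longrightarrow> S \<in> F \<Longrightarrow> S \<inter> fst (state \<omega> k) = {}" for k
    using that
  proof (induction "T - k" arbitrary: k)
    case 0
    then have k: "k = T" by simp
    \<comment> \<open>Only \<open>rest\<close> remains. For \<open>H \<le> 1\<close> all residuals
      are empty; otherwise they are at most \<open>1 + M\<close>, which is below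
      \<open>H + M\<close>.\<close>
    have "card (S \<inter> fst (state \<omega> k)) \<le> \<beta>" if "S \<in> F" for S
    proof (cases "H \<le> 1")
      case True
      then show ?thesis using 0(5)[OF k True that] \<beta>(1) C1 K M_pos by simp
    next
      case False
      then show ?thesis using 0(3)[OF that] k \<beta>(2) by simp
    qed
    then show ?case
      using \<eta> finite_subset[OF state_subset(1) finU] by (intro greedy_on_small) auto
  next
    case (Suc j)
    obtain U' F' where st: "state \<omega> k = (U', F')" by fastforce
    have sub: "U' \<subseteq> U" "F' \<subseteq> F" using state_subset[of \<omega> k] by (auto simp: st)
    have t: "1 \<le> T - k" "T - k \<le> T" "T - k = Suc j" "k < T" using Suc.hyps(2) by auto
    note inv = Suc.prems(2,3)[unfolded st fst_conv snd_conv]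
    show ?case
    proof (cases "H \<le> q ^ (T - k)")
      case False
      have "card (S \<inter> U') \<le> \<beta>" if "S \<in> F" for S
        using inv(1)[OF that] False \<beta>(2) by linarith
      then show ?thesis
        using \<eta> sub finU unfolding st fst_conv by (intro greedy_on_small) (auto intro: finite_subset)
    next
      case True
      let ?J = "phase \<omega> (T - k) U' F'"
      interpret m: manis_run \<eta> n e1 "deg \<omega> (T - k) U' F'" "\<lambda>r S. \<omega> (Priority (T - k) r S)"
         "\<lambda>r S. \<omega> (Pick_Noise (T - k) r S)" "\<lambda>r S. \<omega> (Keep_Noise (T - k) r S)" "fam \<omega> (T - k) U' F'" U'
        by (rule run[OF sub])
      have em: "m.sets_at R = {}"
        using emptied[OF t(4) True] by (simp add: emptied_def st gr_def m.sets_at_def)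
      have st': "state \<omega> (Suc k) = (U' - \<Union>(set ?J), F' - set ?J)" by (simp add: st Let_def)
      have res1: "card (S \<inter> (U' - \<Union>(set ?J))) \<le> q ^ (T - k - 1) + M" if "S \<in> F" for S
        by (rule phase_residual(1)[OF quiet t(1,2) sub]) (fact inv em that)+
      have res2: "S \<inter> (U' - \<Union>(set ?J)) = {}" if "T - k = 1" "H \<le> 1" "S \<in> F" for S
        by (rule phase_residual(2)[OF quiet t(1,2) sub]) (fact inv em that)+
      have gr: "greedy_on F (1 - 5 * \<eta>) \<beta> U' ?J"
        by (rule phase_greedy[OF quiet t(1,2) sub]) (fact inv untied)+
      have Tk: "T - Suc k = T - k - 1" by simp
      have "greedy_on F (1 - 5 * \<eta>) \<beta> (fst (state \<omega> (Suc k)))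
          (cover \<omega> (T - Suc k) (fst (state \<omega> (Suc k))) (snd (state \<omega> (Suc k))))"
      proof (rule Suc.hyps(1))
        show "j = T - Suc k" "Suc k \<le> T" using Suc.hyps(2) by auto
        show "card (S \<inter> fst (state \<omega> (Suc k))) \<le> q ^ (T - Suc k) + M" if "S \<in> F" for S
          using res1[OF that] unfolding st' Tk by simp
        show "S \<inter> fst (state \<omega> (Suc k)) = {}" if "S \<in> F - snd (state \<omega> (Suc k))" for S
          using that inv(2)[of S] unfolding st' by auto
        show "S \<inter> fst (state \<omega> (Suc k)) = {}" if "Suc k = T" "H \<le> 1" "S \<in> F" for S
          using that(1) unfolding st' fst_conv by (intro res2 that) auto
      qed
      moreover have "T - Suc k = j" using t by simp
      ultimately have "greedy_on F (1 - 5 * \<eta>) \<beta> (U' - \<Union>(set ?J)) (cover \<omega> j (U' - \<Union>(set ?J)) (F' - set ?J))"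
        unfolding st' by simp
      then show ?thesis
        unfolding st fst_conv snd_conv t(3) cover_Suc[OF sub]
        using gr by (intro greedy_on_append) (simp_all add: t(3))
    qed
  qed
  note gen = this[of 0]
  have "card (S \<inter> U) \<le> q ^ T + M" for S
  proof -
    have "card (S \<inter> U) \<le> card U" using finU by (intro card_mono) auto
    then show ?thesis using T M_pos by linarith
  qed
  then show ?thesis using gen T0 by simp
qed

lemma prefix_optimal_of_greedy:
  assumes "greedy_on F (1 - 5 * \<eta>) \<beta> U L" "distinct L" "set L = F"
  shows "prefix_optimal F (1 - 5 * \<eta>) \<beta> L"
  unfolding prefix_optimal_def
proof (intro conjI exI[of _ "\<lambda>_. 1 - 5 * \<eta>"] allI impI)
  fix i assume i: "i < length L"
  have LF: "L ! i \<in> F" using assms(3) i nth_mem by blast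
  have "best_gain F L i \<in> (\<lambda>S. card (S - \<Union>(set (take i L)))) ` F"
    unfolding best_gain_def using LF finF by (intro Max_in) auto
  then obtain S where S: "S \<in> F" "best_gain F L i = card (S - \<Union>(set (take i L)))" by auto
  have "X \<inter> U = X" if "X \<in> F" for X using that F by auto
  then show "(1 - 5 * \<eta>) * real (best_gain F L i) - \<beta> \<le> real (card (L ! i - \<Union>(set (take i L))))"
    using assms(1) i S LF by (fastforce simp: greedy_on_def)
qed (use assms in auto)

end

section \<open>Failure probability\<close>

lemma sets_draw_law [simp]: "sets (draw_law e0 e1 d) = sets borel"
  by (cases d) (auto simp: laplace_def)

lemma prob_space_draw_law:
  assumes "0 < e0" "0 < e1"
  shows "prob_space (draw_law e0 e1 d)"
  using assms by (cases d) (auto intro!: prob_space_laplace prob_space_uniform01)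

locale dp_prob = dp_bounds +
  assumes e: "0 < e0" "0 < e1"
begin

abbreviation \<Omega> :: "('a draw \<Rightarrow> real) measure" where "\<Omega> \<equiv> tape e0 e1"

sublocale tp: product_prob_space "draw_law e0 e1 :: 'a draw \<Rightarrow> real measure" UNIV
  by (intro product_prob_space.intro product_sigma_finite.intro product_prob_space_axioms.intro
      prob_space_draw_law prob_space_imp_sigma_finite e)

lemma tape_eq: "\<Omega> = (\<Pi>\<^sub>M d\<in>UNIV. draw_law e0 e1 d)"
  by (simp add: tape_def)

sublocale pt: prob_space \<Omega>
  unfolding tape_eq by (rule tp.P.prob_space_axioms)

lemma component [measurable]: "(\<lambda>\<omega>. \<omega> d) \<in> borel_measurable \<Omega>"
proof -
  have "(\<lambda>\<omega>. \<omega> d) \<in> \<Omega> \<rightarrow>\<^sub>M draw_law e0 e1 d" unfolding tape_eq by simp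
  then show ?thesis using measurable_cong_sets[OF refl sets_draw_law] by blast
qed

lemma prob_component:
  "A \<in> sets borel \<Longrightarrow> pt.prob {\<omega> \<in> space \<Omega>. \<omega> d \<in> A} = measure (draw_law e0 e1 d) A"
  using tp.emeasure_PiM_Collect_single[of d A]
  by (simp add: measure_def tape_eq)

lemma prob_priority:
  assumes "0 \<le> p" "p \<le> 1"
  shows "pt.prob {\<omega> \<in> space \<Omega>. 1 - p \<le> \<omega> (Priority t r S)} = p"
  using prob_component[of "{1 - p..}" "Priority t r S"] uniform01_upper[OF assms] by simp

lemma prob_priority2:
  assumes "0 \<le> p" "p \<le> 1" "S \<noteq> S'"
  shows "pt.prob {\<omega> \<in> space \<Omega>. 1 - p \<le> \<omega> (Priority t r S) \<and> 1 - p \<le> \<omega> (Priority t r S')} = p * p"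
proof -
  let ?J = "{Priority t r S, Priority t r S'}"
  interpret V: prob_space "uniform_measure lborel {0..1::real}" by (rule prob_space_uniform01)
  have u: "emeasure (uniform_measure lborel {0..1}) {1 - p..} = ennreal p"
    using uniform01_upper[OF assms(1,2)] by (simp add: V.emeasure_eq_measure)
  have "emeasure \<Omega> {\<omega> \<in> space \<Omega>. \<forall>d\<in>?J. \<omega> d \<in> {1 - p..}} = (\<Prod>d\<in>?J. emeasure (draw_law e0 e1 d) {1 - p..})"
    unfolding tape_eq by (rule tp.emeasure_PiM_Collect) auto
  also have "\<dots> = ennreal (p * p)" using assms by (simp add: u ennreal_mult)
  finally show ?thesis using assms by (simp add: pt.emeasure_eq_measure)
qed

lemma measurable_quiet: "Measurable.pred \<Omega> quiet"
proof -
  have "Measurable.pred \<Omega> (\<lambda>\<omega>. \<bar>\<omega> d\<bar> \<le> K)" for d by measurable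
  then show ?thesis unfolding quiet_def
    by (intro pred_intros_finite pred_intros_logic pred_intros_conj1' finF) (auto intro!: pred_intros_finite)
qed

lemma AE_untied: "AE \<omega> in \<Omega>. untied \<omega>"
proof -
  have "AE \<omega> in \<Omega>. \<omega> (Priority t r S) \<noteq> \<omega> (Priority t r S')" if "S \<noteq> S'" for t r S S'
    unfolding tape_eq
  proof (rule AE_neq_component[OF prob_space_draw_law[OF e]])
    show "AE x in draw_law e0 e1 (Priority t r S). x \<noteq> c" for c
      unfolding draw_law.simps by (rule uniform01_singleton)
  qed (use that in simp_all)
  then have "AE \<omega> in \<Omega>. \<forall>t\<in>{1..T}. \<forall>r\<in>{..R}. \<forall>S\<in>F. \<forall>S'\<in>F. S \<noteq> S' \<longrightarrow> \<omega> (Priority t r S) \<noteq> \<omega> (Priority t r S')"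
    by (intro AE_finite_allI finite_atLeastAtMost finite_atMost finF) auto
  then show ?thesis
  proof eventually_elim
    case (elim \<omega>)
    show ?case unfolding untied_def inj_on_def
    proof (intro ballI allI impI, rule ccontr)
      fix t r S S' assume "t \<in> {1..T}" "r \<le> R" "S \<in> F" "S' \<in> F"
        "\<omega> (Priority t r S) = \<omega> (Priority t r S')" "S \<noteq> S'"
      then show False using elim by (meson atMost_iff)
    qed
  qed
qed

section \<open>Decay of the number of edges within a phase\<close>

definition num_edges :: "('a draw \<Rightarrow> real) \<Rightarrow> nat \<Rightarrow> nat \<Rightarrow> nat" where
  "num_edges \<omega> k r = card (snd (snd (gr \<omega> (T - k) (fst (state \<omega> k)) (snd (state \<omega> k)) r)))"

lemma measurable_num_edges:
  assumes "k < T" "r \<le> Suc R"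
  shows "(\<lambda>\<omega>. of_bool (quiet \<omega>) * ennreal (num_edges \<omega> k r)) \<in> borel_measurable \<Omega>"
proof -
  have "simple_function \<Omega> (\<lambda>\<omega>. ennreal (num_edges \<omega> k r))"
    unfolding num_edges_def
    by (rule simple_function_compose1[OF simple_function_gr[OF component assms]])
  then have [measurable]: "(\<lambda>\<omega>. ennreal (num_edges \<omega> k r)) \<in> borel_measurable \<Omega>"
    by (rule borel_measurable_simple_function)
  note measurable_quiet[measurable]
  show ?thesis by measurable
qed

context
  fixes k r :: nat and J :: "'a draw set" and y \<omega> :: "'a draw \<Rightarrow> real"
  assumes k: "k < T" and J: "J = {d. \<exists>S. d = Priority (T - k) r S}"
begin

lemma resample_simps:
  "resample J y \<omega> (Size_Noise t S) = \<omega> (Size_Noise t S)"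
  "resample J y \<omega> (Deg_Noise t S) = \<omega> (Deg_Noise t S)"
  "resample J y \<omega> (Pick_Noise t r' S) = \<omega> (Pick_Noise t r' S)"
  "resample J y \<omega> (Keep_Noise t r' S) = \<omega> (Keep_Noise t r' S)"
  "resample J y \<omega> (Priority t r' S) = (if t = T - k \<and> r' = r then y (Priority t r' S) else \<omega> (Priority t r' S))"
  by (auto simp: resample_def J)

lemma resample_quiet: "quiet (resample J y \<omega>) = quiet \<omega>"
  by (simp add: quiet_def resample_simps)

lemma resample_fam: "fam (resample J y \<omega>) t U' F' = fam \<omega> t U' F'"
  by (simp add: fam_def resample_simps)

lemma resample_deg: "deg (resample J y \<omega>) t U' F' = deg \<omega> t U' F'"
  by (simp add: deg_def resample_fam fun_eq_iff resample_simps)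

lemma resample_state: "j \<le> k \<Longrightarrow> state (resample J y \<omega>) j = state \<omega> j"
proof (induction j)
  case (Suc j)
  \<comment> \<open>\<open>k < T\<close> excludes truncation, so the earlier phases have other
    indices and read no resampled coordinate.\<close>
  have "T - j \<noteq> T - k" using Suc.prems k by auto
  then have "phase (resample J y \<omega>) (T - j) U' F' = phase \<omega> (T - j) U' F'" for U' F'
    by (simp add: phase_def resample_fam resample_deg resample_simps)
  then show ?case using Suc by (simp add: split_beta Let_def)
qed simp

text \<open>The graph entering round \<open>r\<close> is unaffected by its priorities. Besides the
  elements covered by picked sets, the keep test deletes further edges, whence only an inclusion.
  The right-hand side is what \<open>manis_round\<close> counts, with the coordinates of
  \<open>y\<close> as priorities.\<close>

lemma resample_edges:
  assumes sub: "U' \<subseteq> U" "F' \<subseteq> F" and g: "gr \<omega> (T - k) U' F' r = (A, B, incidence A B)"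
  shows "snd (snd (gr (resample J y \<omega>) (T - k) U' F' (Suc r))) \<subseteq>
    {e \<in> incidence A B. snd e \<notin> incidence A B `` manis_picked \<eta> (deg \<omega> (T - k) U' F') (\<lambda>S. y (Priority (T - k) r S))
       (\<lambda>S. \<omega> (Pick_Noise (T - k) r S)) (A, B, incidence A B)}"
proof -
  let ?t = "T - k"
  interpret m: manis_run \<eta> n e1 "deg \<omega> ?t U' F'" "\<lambda>r S. \<omega> (Priority ?t r S)"
     "\<lambda>r S. \<omega> (Pick_Noise ?t r S)" "\<lambda>r S. \<omega> (Keep_Noise ?t r S)" "fam \<omega> ?t U' F'" U'
    using run[OF sub] .
  interpret m': manis_run \<eta> n e1 "deg \<omega> ?t U' F'" "\<lambda>r' S. resample J y \<omega> (Priority ?t r' S)"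
     "\<lambda>r S. \<omega> (Pick_Noise ?t r S)" "\<lambda>r S. \<omega> (Keep_Noise ?t r S)" "fam \<omega> ?t U' F'" U'
    using run[OF sub] .
  have "m'.graph r = m.graph r"
    by (rule m.graph_cong(1)) (auto simp: resample_simps)
  then have g': "m'.graph r = (A, B, incidence A B)" using g by (simp add: gr_def m.graph_def)
  have p: "m'.picked_at r = manis_picked \<eta> (deg \<omega> ?t U' F') (\<lambda>S. y (Priority ?t r S))
      (\<lambda>S. \<omega> (Pick_Noise ?t r S)) (A, B, incidence A B)"
    unfolding m'.picked_at_def g' by (simp add: resample_simps)
  have AB: "A = m'.sets_at r" "B = m'.elems_at r" unfolding m'.sets_at_def m'.elems_at_def g' by simp_all
  have "snd (snd (m'.graph (Suc r))) = incidence (m'.sets_at (Suc r)) (m'.elems_at (Suc r))"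
    by (subst m'.graph_eq) simp
  also have "\<dots> \<subseteq> {e \<in> incidence A B. snd e \<notin> incidence A B `` m'.picked_at r}"
    using m'.picked_subset[of r] m'.sets_at_antimono[of r "Suc r"] unfolding AB
    by (auto simp: incidence_def m'.elems_at_Suc)
  finally show ?thesis
    unfolding p gr_def resample_fam resample_deg resample_simps(1-4) m'.graph_def .
qed

end

text \<open>
  The graph of round \<open>r\<close> and the event \<open>quiet\<close> do not involve the priorities of round \<open>r\<close>, so these may be
  resampled with everything else fixed.
\<close>

lemma num_edges_shrink:
  assumes k: "k < T" and r: "r < R" and large: "H \<le> q ^ (T - k)"
  shows "(\<integral>\<^sup>+\<omega>. of_bool (quiet \<omega>) * ennreal (num_edges \<omega> k (Suc r)) \<partial>\<Omega>)
    \<le> ennreal (1 - \<eta>\<^sup>2 / 128) * (\<integral>\<^sup>+\<omega>. of_bool (quiet \<omega>) * ennreal (num_edges \<omega> k r) \<partial>\<Omega>)"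
proof -
  let ?t = "T - k"
  define J where "J = {d :: 'a draw. \<exists>S. d = Priority (T - k) r S}"
  \<comment> \<open>With \<omega> fixed, the graph, the degrees and the pick noise are constants and
    only the priorities \<open>y\<close> are random: the setting of
    \<open>manis_round\<close>.\<close>
  have inner: "(\<integral>\<^sup>+y. of_bool (quiet (resample J y \<omega>)) * ennreal (num_edges (resample J y \<omega>) k (Suc r)) \<partial>\<Omega>)
      \<le> ennreal (1 - \<eta>\<^sup>2 / 128) * (of_bool (quiet \<omega>) * ennreal (num_edges \<omega> k r))" for \<omega>
  proof (cases "quiet \<omega>")
    case True
    obtain U' F' where st: "state \<omega> k = (U', F')" by fastforce
    have sub: "U' \<subseteq> U" "F' \<subseteq> F" using state_subset[of \<omega> k] by (auto simp: st)
    interpret m: manis_run \<eta> n e1 "deg \<omega> ?t U' F'" "\<lambda>r S. \<omega> (Priority ?t r S)"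
       "\<lambda>r S. \<omega> (Pick_Noise ?t r S)" "\<lambda>r S. \<omega> (Keep_Noise ?t r S)" "fam \<omega> ?t U' F'" U'
      using run[OF sub] .
    define A B where "A = m.sets_at r" and "B = m.elems_at r"
    define E where "E = incidence A B"
    let ?P = "\<lambda>y. manis_picked \<eta> (deg \<omega> ?t U' F') (\<lambda>S. y (Priority ?t r S))
       (\<lambda>S. \<omega> (Pick_Noise ?t r S)) (A, B, E)"
    have g: "gr \<omega> ?t U' F' r = (A, B, E)"
      using m.graph_eq[of r] by (simp add: gr_def A_def B_def E_def)
    have fin: "finite A" "finite B" using m.fin_at by (auto simp: A_def B_def)
    have fE: "finite E" unfolding E_def using fin by (rule finite_incidence)
    have "num_edges (resample J y \<omega>) k (Suc r) \<le> card {e \<in> E. snd e \<notin> E `` ?P y}" for y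
      using resample_edges[OF k J_def sub g[unfolded E_def], of y] fE
        resample_state[OF k J_def order_refl, of y \<omega>]
      by (auto simp: num_edges_def st E_def intro!: card_mono)
    then have "(\<integral>\<^sup>+y. of_bool (quiet (resample J y \<omega>)) * ennreal (num_edges (resample J y \<omega>) k (Suc r)) \<partial>\<Omega>)
        \<le> (\<integral>\<^sup>+y. ennreal (card {e \<in> E. snd e \<notin> E `` ?P y}) \<partial>\<Omega>)"
      by (intro nn_integral_mono) (simp add: resample_quiet[OF k J_def] True)
    also have "\<dots> \<le> ennreal ((1 - \<eta>\<^sup>2 / 128) * card E)"
    proof (rule pt.manis_round[OF fin])
      show "E \<subseteq> A \<times> B" by (auto simp: E_def incidence_def)
      show "(1 - 4 * \<eta>) * deg \<omega> ?t U' F' a \<le> (1 - \<eta> / 2) * (1 - \<eta> / 8) * card (E `` {a}) + \<omega> (Pick_Noise ?t r a)"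
        if "a \<in> A" for a
        using deg_large(1)[OF True _ _ sub that[unfolded A_def] _ large] k r that
        by (simp add: E_def incidence_Image B_def Int_commute Suc_le_eq)
    qed (use \<eta> prob_priority prob_priority2 in auto)
    also have "\<dots> = ennreal (1 - \<eta>\<^sup>2 / 128) * ennreal (card E)"
    proof (rule ennreal_mult)
      have "\<eta>\<^sup>2 \<le> 1" using \<eta> by (intro power_le_one) auto
      then show "0 \<le> 1 - \<eta>\<^sup>2 / 128" by simp
    qed simp
    finally show ?thesis using True g by (simp add: num_edges_def st)
  qed (simp add: resample_quiet[OF k J_def])
  have "(\<integral>\<^sup>+\<omega>. of_bool (quiet \<omega>) * ennreal (num_edges \<omega> k (Suc r)) \<partial>\<Omega>)
      = (\<integral>\<^sup>+\<omega>. \<integral>\<^sup>+y. of_bool (quiet (resample J y \<omega>)) * ennreal (num_edges (resample J y \<omega>) k (Suc r)) \<partial>\<Omega> \<partial>\<Omega>)"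
    using tp.nn_integral_resample[OF refl measurable_num_edges[unfolded tape_eq], of k "Suc r" J] k r
    by (simp add: tape_eq)
  also have "\<dots> \<le> (\<integral>\<^sup>+\<omega>. ennreal (1 - \<eta>\<^sup>2 / 128) * (of_bool (quiet \<omega>) * ennreal (num_edges \<omega> k r)) \<partial>\<Omega>)"
    by (intro nn_integral_mono inner)
  also have "\<dots> = ennreal (1 - \<eta>\<^sup>2 / 128) * (\<integral>\<^sup>+\<omega>. of_bool (quiet \<omega>) * ennreal (num_edges \<omega> k r) \<partial>\<Omega>)"
    using k r by (intro nn_integral_cmult measurable_num_edges) auto
  finally show ?thesis .
qed

lemma quiet_num_edges:
  assumes k: "k < T" and large: "H \<le> q ^ (T - k)"
  shows "r \<le> R \<Longrightarrow> (\<integral>\<^sup>+\<omega>. of_bool (quiet \<omega>) * ennreal (num_edges \<omega> k r) \<partial>\<Omega>)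
    \<le> ennreal ((1 - \<eta>\<^sup>2 / 128) ^ r * (card F * card U))"
proof (induction r)
  case 0
  have "num_edges \<omega> k 0 \<le> card F * card U" for \<omega>
  proof -
    obtain U' F' where st: "state \<omega> k = (U', F')" by fastforce
    have sub: "U' \<subseteq> U" "F' \<subseteq> F" using state_subset[of \<omega> k] by (auto simp: st)
    interpret m: manis_run \<eta> n e1 "deg \<omega> (T - k) U' F'" "\<lambda>r S. \<omega> (Priority (T - k) r S)"
       "\<lambda>r S. \<omega> (Pick_Noise (T - k) r S)" "\<lambda>r S. \<omega> (Keep_Noise (T - k) r S)" "fam \<omega> (T - k) U' F'" U'
      using run[OF sub] .
    have "num_edges \<omega> k 0 = card (incidence (fam \<omega> (T - k) U' F') U')"
      by (simp add: num_edges_def st gr_def m.graph_eq flip: m.graph_def)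
    also have "\<dots> \<le> card (F \<times> U)"
      using fam_subset[of \<omega> "T - k" U' F'] sub finF finU by (intro card_mono) (auto simp: incidence_def)
    finally show ?thesis by (simp add: card_cartesian_product)
  qed
  then have "(\<integral>\<^sup>+\<omega>. of_bool (quiet \<omega>) * ennreal (num_edges \<omega> k 0) \<partial>\<Omega>) \<le> (\<integral>\<^sup>+\<omega>. ennreal (card F * card U) \<partial>\<Omega>)"
    by (intro nn_integral_mono) (auto simp: of_bool_def simp del: of_nat_mult intro!: ennreal_leI)
  then show ?case by (simp add: pt.emeasure_space_1)
next
  case (Suc r)
  have c: "0 \<le> 1 - \<eta>\<^sup>2 / 128" using power_le_one[of \<eta> 2] \<eta> by simp
  have "(\<integral>\<^sup>+\<omega>. of_bool (quiet \<omega>) * ennreal (num_edges \<omega> k (Suc r)) \<partial>\<Omega>)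
      \<le> ennreal (1 - \<eta>\<^sup>2 / 128) * (\<integral>\<^sup>+\<omega>. of_bool (quiet \<omega>) * ennreal (num_edges \<omega> k r) \<partial>\<Omega>)"
    using num_edges_shrink[OF k _ large] Suc.prems by simp
  also have "\<dots> \<le> ennreal (1 - \<eta>\<^sup>2 / 128) * ennreal ((1 - \<eta>\<^sup>2 / 128) ^ r * (card F * card U))"
    using Suc by (intro mult_left_mono) auto
  also have "\<dots> = ennreal ((1 - \<eta>\<^sup>2 / 128) ^ Suc r * (card F * card U))"
    using c by (subst ennreal_mult[symmetric]) (auto simp: mult.assoc)
  finally show ?case .
qed

text \<open>A surviving set of a large phase is not isolated, so surviving sets are detected by the
  number of edges.\<close>

lemma num_edges_pos:
  assumes k: "k < T" and large: "H \<le> q ^ (T - k)" and quiet: "quiet \<omega>" and ne: "\<not> emptied \<omega> k"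
  shows "1 \<le> num_edges \<omega> k R"
proof -
  obtain U' F' where st: "state \<omega> k = (U', F')" by fastforce
  have sub: "U' \<subseteq> U" "F' \<subseteq> F" using state_subset[of \<omega> k] by (auto simp: st)
  interpret m: manis_run \<eta> n e1 "deg \<omega> (T - k) U' F'" "\<lambda>r S. \<omega> (Priority (T - k) r S)"
     "\<lambda>r S. \<omega> (Pick_Noise (T - k) r S)" "\<lambda>r S. \<omega> (Keep_Noise (T - k) r S)" "fam \<omega> (T - k) U' F'" U'
    using run[OF sub] .
  obtain S where S: "S \<in> m.sets_at R"
    using ne by (auto simp: emptied_def st gr_def m.sets_at_def)
  have "S \<inter> m.elems_at R \<noteq> {}"
    by (rule deg_large(2)[OF quiet _ _ sub S order_refl large]) (use k in auto)
  then have "incidence (m.sets_at R) (m.elems_at R) \<noteq> {}" using S by (auto simp: incidence_def)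
  moreover have "finite (incidence (m.sets_at R) (m.elems_at R))" by (intro finite_incidence m.fin_at)
  ultimately have "0 < card (incidence (m.sets_at R) (m.elems_at R))" by (simp add: card_gt_0_iff)
  moreover have "num_edges \<omega> k R = card (incidence (m.sets_at R) (m.elems_at R))"
    using m.graph_eq[of R] by (simp add: num_edges_def st gr_def)
  ultimately show ?thesis by simp
qed

lemma prob_not_emptied:
  assumes k: "k < T" and large: "H \<le> q ^ (T - k)"
  shows "{\<omega> \<in> space \<Omega>. quiet \<omega> \<and> \<not> emptied \<omega> k} \<in> sets \<Omega>"
    and "pt.prob {\<omega> \<in> space \<Omega>. quiet \<omega> \<and> \<not> emptied \<omega> k} \<le> (1 - \<eta>\<^sup>2 / 128) ^ R * (card F * card U)"
proof -
  have "simple_function \<Omega> (\<lambda>\<omega>. emptied \<omega> k)"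
    unfolding emptied_def
    by (rule simple_function_compose1[OF simple_function_gr[OF component k]]) simp
  then have "Measurable.pred \<Omega> (\<lambda>\<omega>. emptied \<omega> k)"
    by (rule measurable_simple_function)
  then show m: "{\<omega> \<in> space \<Omega>. quiet \<omega> \<and> \<not> emptied \<omega> k} \<in> sets \<Omega>"
    using measurable_quiet unfolding pred_def by (intro sets.sets_Collect_conj sets.sets_Collect_neg) auto
  have "emeasure \<Omega> {\<omega> \<in> space \<Omega>. quiet \<omega> \<and> \<not> emptied \<omega> k}
      = (\<integral>\<^sup>+\<omega>. indicator {\<omega> \<in> space \<Omega>. quiet \<omega> \<and> \<not> emptied \<omega> k} \<omega> \<partial>\<Omega>)"
    using m by simp
  \<comment> \<open>Markov's inequality at level 1: the indicator is at most the weighted number of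
    edges.\<close>
  also have "\<dots> \<le> (\<integral>\<^sup>+\<omega>. of_bool (quiet \<omega>) * ennreal (num_edges \<omega> k R) \<partial>\<Omega>)"
    using num_edges_pos[OF k large] by (intro nn_integral_mono) (auto simp: indicator_def)
  also have "\<dots> \<le> ennreal ((1 - \<eta>\<^sup>2 / 128) ^ R * (card F * card U))"
    by (rule quiet_num_edges[OF k large order_refl])
  finally show "pt.prob {\<omega> \<in> space \<Omega>. quiet \<omega> \<and> \<not> emptied \<omega> k} \<le> (1 - \<eta>\<^sup>2 / 128) ^ R * (card F * card U)"
    using power_le_one[of \<eta> 2] \<eta> by (simp add: pt.emeasure_eq_measure)
qed

text \<open>\<open>s\<close> measures the tail in units of the scale: \<open>K\<close> is at least
  \<open>s\<close> times each of the scales \<open>1 / e0\<close>, \<open>2 / e1\<close>,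
  \<open>1 / e1\<close>. The union bound runs over \<open>2 + 2 * (R + 1)\<close> Laplace draws per
  phase and set.\<close>

lemma prob_not_quiet:
  assumes s0: "0 \<le> s" and s: "s / e0 \<le> K" "2 * s / e1 \<le> K"
  shows "pt.prob {\<omega> \<in> space \<Omega>. \<not> quiet \<omega>} \<le> T * card F * (2 * R + 4) * (2 * exp (- s / 2))"
proof -
  define D where "D = (\<Union>t\<in>{1..T}. \<Union>S\<in>F. {Size_Noise t S, Deg_Noise t S} \<union>
    (\<lambda>r. Pick_Noise t r S) ` {..R} \<union> (\<lambda>r. Keep_Noise t r S) ` {..R})"
  have tail: "pt.prob {\<omega> \<in> space \<Omega>. \<omega> d \<in> {x. K < \<bar>x\<bar>}} \<le> 2 * exp (- s / 2)" if "d \<in> D" for d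
  proof -
    obtain b where b: "0 < b" "s * b \<le> K" "draw_law e0 e1 d = laplace b"
    proof -
      have "s * (1 / e1) \<le> 2 * s / e1" using s0 e by (simp add: field_simps)
      then have "s * (1 / e1) \<le> K" using s(2) by (rule order_trans)
      moreover have "s * (1 / e0) \<le> K" "s * (2 / e1) \<le> K" using s by (simp_all add: mult.commute)
      ultimately have sK: "s * (1 / e0) \<le> K" "s * (2 / e1) \<le> K" "s * (1 / e1) \<le> K" by auto
      have "draw_law e0 e1 d = laplace (1 / e0) \<or> draw_law e0 e1 d = laplace (2 / e1) \<or>
          draw_law e0 e1 d = laplace (1 / e1)"
        using \<open>d \<in> D\<close> unfolding D_def by auto
      then show ?thesis
        using that[OF _ sK(1)] that[OF _ sK(2)] that[OF _ sK(3)] e by auto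
    qed
    interpret L: prob_space "laplace b" by (rule prob_space_laplace[OF b(1)])
    have "pt.prob {\<omega> \<in> space \<Omega>. \<omega> d \<in> {x. K < \<bar>x\<bar>}} = measure (laplace b) {x. K < \<bar>x\<bar>}"
      using b(3) by (subst prob_component) simp_all
    also have "\<dots> \<le> measure (laplace b) {x. s * b < \<bar>x\<bar>}"
      using b(2) by (intro L.finite_measure_mono) (auto simp: laplace_def)
    also have "\<dots> \<le> 2 * exp (- s / 2)" by (rule measure_laplace_tail[OF b(1)])
    finally show ?thesis .
  qed
  have cD: "card D \<le> T * card F * (2 * R + 4)" and fD: "finite D"
  proof -
    show "finite D" unfolding D_def using finF by auto
    have "card D \<le> (\<Sum>t\<in>{1..T}. \<Sum>S\<in>F. 2 * R + 4)"
      unfolding D_def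
    proof (intro order_trans[OF card_UN_le] sum_mono finF finite_atLeastAtMost)
      fix t S
      let ?A = "{Size_Noise t S, Deg_Noise t S}" and ?B = "(\<lambda>r. Pick_Noise t r S) ` {..R}"
        and ?C = "(\<lambda>r. Keep_Noise t r S) ` {..R}"
      have "card (?A \<union> ?B \<union> ?C) \<le> card ?A + card ?B + card ?C"
        by (meson add_le_mono1 card_Un_le le_trans)
      also have "\<dots> \<le> 2 + Suc R + Suc R"
        using card_image_le[of "{..R}" "\<lambda>r. Pick_Noise t r S"] card_image_le[of "{..R}" "\<lambda>r. Keep_Noise t r S"]
        by (intro add_mono) (auto simp: card_insert_if)
      finally show "card (?A \<union> ?B \<union> ?C) \<le> 2 * R + 4" by simp
    qed
    then show "card D \<le> T * card F * (2 * R + 4)" by simp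
  qed
  have sets: "{\<omega> \<in> space \<Omega>. \<omega> d \<in> {x. K < \<bar>x\<bar>}} \<in> sets \<Omega>" for d
    by measurable
  have "{\<omega> \<in> space \<Omega>. \<not> quiet \<omega>} \<subseteq> (\<Union>d\<in>D. {\<omega> \<in> space \<Omega>. \<omega> d \<in> {x. K < \<bar>x\<bar>}})"
  proof -
    have D: "\<And>t S. t \<in> {1..T} \<Longrightarrow> S \<in> F \<Longrightarrow> Size_Noise t S \<in> D \<and> Deg_Noise t S \<in> D \<and>
        (\<forall>r\<le>R. Pick_Noise t r S \<in> D \<and> Keep_Noise t r S \<in> D)"
      unfolding D_def by blast
    have "quiet \<omega>" if "\<And>d. d \<in> D \<Longrightarrow> \<bar>\<omega> d\<bar> \<le> K" for \<omega>
      unfolding quiet_def using D that by blast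
    then show ?thesis by (auto simp: not_less[symmetric])
  qed
  then have "pt.prob {\<omega> \<in> space \<Omega>. \<not> quiet \<omega>} \<le> pt.prob (\<Union>d\<in>D. {\<omega> \<in> space \<Omega>. \<omega> d \<in> {x. K < \<bar>x\<bar>}})"
    using fD sets by (intro pt.finite_measure_mono) auto
  also have "\<dots> \<le> (\<Sum>d\<in>D. pt.prob {\<omega> \<in> space \<Omega>. \<omega> d \<in> {x. K < \<bar>x\<bar>}})"
    using fD sets by (intro pt.finite_measure_subadditive_finite) auto
  also have "\<dots> \<le> (\<Sum>d\<in>D. 2 * exp (- s / 2))" by (intro sum_mono tail)
  also have "\<dots> = card D * (2 * exp (- s / 2))" by simp
  also have "\<dots> \<le> (T * card F * (2 * R + 4)) * (2 * exp (- s / 2))"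
    using cD by (intro mult_right_mono of_nat_mono) (simp_all flip: of_nat_mult of_nat_add)
  finally show ?thesis by simp
qed

lemma prob_prefix_optimal:
  assumes s0: "0 \<le> s" and s: "s / e0 \<le> K" "2 * s / e1 \<le> K" and T0: "0 < T"
    and rest: "\<And>X. finite X \<Longrightarrow> distinct (rest X) \<and> set (rest X) = X"
  shows "1 - (T * card F * (2 * R + 4) * (2 * exp (- s / 2)) + T * ((1 - \<eta>\<^sup>2 / 128) ^ R * (card F * card U)))
    \<le> pt.prob {\<omega> \<in> space \<Omega>. prefix_optimal F (1 - 5 * \<eta>) \<beta> (cover \<omega> T U F)}"
proof -
  let ?G = "{\<omega> \<in> space \<Omega>. prefix_optimal F (1 - 5 * \<eta>) \<beta> (cover \<omega> T U F)}"
  let ?Q = "{\<omega> \<in> space \<Omega>. \<not> quiet \<omega>}"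
  define L where "L = {k. k < T \<and> H \<le> q ^ (T - k)}"
  let ?E = "\<lambda>k. {\<omega> \<in> space \<Omega>. quiet \<omega> \<and> \<not> emptied \<omega> k}"
  have fL: "finite L" "card L \<le> T"
    using card_mono[of "{..<T}" L] by (auto simp: L_def intro: finite_subset[of _ "{..<T}"])
  have mG: "?G \<in> sets \<Omega>"
  proof -
    have "simple_function \<Omega> (\<lambda>\<omega>. prefix_optimal F (1 - 5 * \<eta>) \<beta> (cover \<omega> T U F))"
      by (rule simple_function_compose1[OF simple_function_cover[OF component]])
    then have "Measurable.pred \<Omega> (\<lambda>\<omega>. prefix_optimal F (1 - 5 * \<eta>) \<beta> (cover \<omega> T U F))"
      by (rule measurable_simple_function)
    then show ?thesis by (simp add: pred_def)
  qed
  have mQ: "?Q \<in> sets \<Omega>" using measurable_quiet unfolding pred_def by (intro sets.sets_Collect_neg)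
  have mE: "?E k \<in> sets \<Omega>" if "k \<in> L" for k using prob_not_emptied(1) that by (simp add: L_def)
  \<comment> \<open>Ties are excluded up to a null set. Failure to empty the graph is intersected
    with \<open>quiet\<close> because the edges were counted only there.\<close>
  have "AE \<omega> in \<Omega>. \<omega> \<in> space \<Omega> - ?G \<longrightarrow> \<omega> \<in> ?Q \<union> (\<Union>k\<in>L. ?E k)"
    using AE_untied
  proof eventually_elim
    case (elim \<omega>)
    have "\<omega> \<in> ?G" if "\<omega> \<in> space \<Omega>" "quiet \<omega>" "\<And>k. k \<in> L \<Longrightarrow> emptied \<omega> k"
    proof -
      have "greedy_on F (1 - 5 * \<eta>) \<beta> U (cover \<omega> T U F)"
        by (rule greedy_cover[OF that(2) elim _ T0]) (use that(3) in \<open>simp add: L_def\<close>)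
      then show ?thesis
        using prefix_optimal_of_greedy cover_permutes[OF rest order_refl order_refl] that(1) by simp
    qed
    then show ?case by auto
  qed
  then have "pt.prob (space \<Omega> - ?G) \<le> pt.prob (?Q \<union> (\<Union>k\<in>L. ?E k))"
    using mQ mE fL by (intro pt.finite_measure_mono_AE) auto
  also have "\<dots> \<le> pt.prob ?Q + pt.prob (\<Union>k\<in>L. ?E k)"
    using mQ mE fL by (intro measure_Un_le) auto
  also have "pt.prob (\<Union>k\<in>L. ?E k) \<le> (\<Sum>k\<in>L. pt.prob (?E k))"
    using mE fL by (intro pt.finite_measure_subadditive_finite) auto
  also have "\<dots> \<le> (\<Sum>k\<in>L. (1 - \<eta>\<^sup>2 / 128) ^ R * (card F * card U))"
    by (intro sum_mono prob_not_emptied(2)) (auto simp: L_def)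
  also have "\<dots> \<le> T * ((1 - \<eta>\<^sup>2 / 128) ^ R * (card F * card U))"
    using fL power_le_one[of \<eta> 2] \<eta> by (simp add: mult_right_mono)
  also have "pt.prob ?Q \<le> T * card F * (2 * R + 4) * (2 * exp (- s / 2))"
    by (rule prob_not_quiet[OF s0 s])
  finally show ?thesis using mG by (simp add: pt.prob_compl)
qed

end

section \<open>Choice of the constants\<close>

lemma prob_prefix_optimal_large_eta:
  fixes \<eta> :: real
  assumes \<eta>: "1 / 5 \<le> \<eta>" "\<eta> < 1" and U: "finite U" "2 \<le> card U" "F \<subseteq> Pow U" and \<epsilon>: "0 < \<epsilon>" and C1': "0 < C1'"
    and rest: "\<And>X. finite X \<Longrightarrow> distinct (rest X) \<and> set (rest X) = X"
  shows "\<P>(\<omega> in dp_cover_tape \<eta> C1' U \<epsilon>. prefix_optimal F (1 - 5 * \<eta>) 0 (dp_cover \<eta> C1 C1' C2' rest U F \<epsilon> \<omega>)) = 1"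
proof -
  define e0 where "e0 = eps0 \<eta> (real (card U)) \<epsilon>"
  define e1 where "e1 = eps1 C1' (real (card U)) e0"
  have "1 < 1 / (1 - \<eta>)" using \<eta> by simp
  then have e: "0 < e0" "0 < e1" using U \<epsilon> C1' by (auto simp: e0_def e1_def eps0_def eps1_def)
  have ps: "prob_space (dp_cover_tape \<eta> C1' U \<epsilon>)"
    unfolding dp_cover_tape_def Let_def e0_def[symmetric] e1_def[symmetric] tape_def
    by (intro prob_space_PiM prob_space_draw_law e)
  interpret dp_run \<eta> "real (card U)" e0 e1 C1 C2' rest U F "nat \<lceil>log (1 / (1 - \<eta>)) (real (card U))\<rceil>"
    using U by unfold_locales auto
  have "prefix_optimal F (1 - 5 * \<eta>) 0 (dp_cover \<eta> C1 C1' C2' rest U F \<epsilon> \<omega>)" for \<omega>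
  proof -
    have "distinct (dp_cover \<eta> C1 C1' C2' rest U F \<epsilon> \<omega>) \<and> set (dp_cover \<eta> C1 C1' C2' rest U F \<epsilon> \<omega>) = F"
      using cover_permutes[OF rest order_refl order_refl] by (simp add: dp_cover_def Let_def e0_def e1_def)
    \<comment> \<open>As \<open>1 - 5 * \<eta> \<le> 0\<close>, zero coefficients work for every
      permutation of \<open>F\<close>.\<close>
    then show ?thesis using \<eta> by (auto simp: prefix_optimal_def intro!: exI[of _ "\<lambda>_. 0"])
  qed
  then show ?thesis using prob_space.prob_space[OF ps] by simp
qed

text \<open>\<open>N\<close> stands for \<open>card F\<close>. Both exponentials are of order
  \<open>1 / n ^ (\<kappa> + 4)\<close>: \<open>n ^ \<kappa>\<close> pays for \<open>N\<close>, one
  factor \<open>n\<close> for \<open>T\<close>, and another for the draws per set or for the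
  elements. The crude linear bounds on \<open>T\<close> and \<open>R\<close> leave
  \<open>1 / n\<^sup>2\<close> without a logarithm.\<close>

lemma failure_bound:
  fixes \<eta> C2' n N s :: real and \<kappa> R T :: nat
  assumes \<eta>: "0 < \<eta>" "\<eta> < 1" and C2': "(real \<kappa> + 4) / (\<eta>\<^sup>2 / 128) \<le> C2'" and n: "2 \<le> n" and N: "0 \<le> N" "N \<le> n ^ \<kappa>"
    and R: "R = nat \<lfloor>C2' * ln n\<rfloor>" and T: "T = nat \<lceil>log (1 / (1 - \<eta>)) n\<rceil>"
    and s: "s = 2 * (real \<kappa> + 4) * ln n"
  shows "T * N * (2 * R + 4) * (2 * exp (- s / 2)) + T * ((1 - \<eta>\<^sup>2 / 128) ^ R * (N * n))
    \<le> ((1 / ln (1 / (1 - \<eta>)) + 1) * (2 * (2 * C2' + 4) + exp (\<eta>\<^sup>2 / 128))) / n\<^sup>2"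
proof -
  define c where "c = \<eta>\<^sup>2 / 128"
  define a where "a = 1 / ln (1 / (1 - \<eta>)) + 1"
  define b where "b = 2 * C2' + 4"
  have c: "0 < c" "c \<le> 1" using \<eta> power_le_one[of \<eta> 2] by (auto simp: c_def)
  have C2: "0 \<le> C2'" using C2' c by (auto simp: c_def[symmetric] intro: order_trans[rotated])
  have lnn: "0 < ln n" "ln n \<le> n" using n ln_le_minus_one[of n] by auto
  have lnq: "0 < ln (1 / (1 - \<eta>))" using \<eta> by simp
  have pn: "exp (- ((real \<kappa> + 4) * ln n)) = 1 / n ^ (\<kappa> + 4)"
  proof -
    have "exp ((real \<kappa> + 4) * ln n) = exp (ln n) ^ (\<kappa> + 4)" by (subst exp_of_nat_mult[symmetric]) simp
    then have "exp ((real \<kappa> + 4) * ln n) = n ^ (\<kappa> + 4)" using n by simp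
    then show ?thesis by (simp only: exp_minus inverse_eq_divide)
  qed
  have T': "real T \<le> a * n"
  proof -
    have "0 \<le> log (1 / (1 - \<eta>)) n" using n lnq by (simp add: log_def)
    then have "real T \<le> log (1 / (1 - \<eta>)) n + 1" unfolding T by linarith
    also have "\<dots> \<le> n / ln (1 / (1 - \<eta>)) + n"
      unfolding log_def using lnn lnq n by (intro add_mono divide_right_mono) auto
    finally show ?thesis by (simp add: a_def algebra_simps)
  qed
  have R': "real (2 * R + 4) \<le> b * n" "C2' * ln n - 1 \<le> R"
  proof -
    have p: "0 \<le> C2' * ln n" using C2 lnn n by (intro mult_nonneg_nonneg) auto
    have "real R \<le> C2' * ln n" unfolding R using p by linarith
    also have "\<dots> \<le> C2' * n" using C2 lnn by (intro mult_left_mono) auto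
    finally show "real (2 * R + 4) \<le> b * n" using n by (simp add: b_def algebra_simps)
    show "C2' * ln n - 1 \<le> R" unfolding R using p by linarith
  qed
  \<comment> \<open>The factor \<open>exp c\<close> pays for rounding \<open>R\<close> down.\<close>
  have pR: "(1 - c) ^ R \<le> exp c * (1 / n ^ (\<kappa> + 4))"
  proof -
    have "(1 - c) ^ R \<le> exp (- c) ^ R" using c exp_ge_add_one_self[of "- c"] by (intro power_mono) auto
    also have "\<dots> = exp (- (c * R))" by (simp add: exp_of_nat_mult[symmetric] mult.commute)
    also have "\<dots> \<le> exp (c + - ((real \<kappa> + 4) * ln n))"
    proof -
      have "(real \<kappa> + 4) * ln n \<le> c * C2' * ln n"
        using C2' c lnn n by (intro mult_right_mono) (auto simp: c_def[symmetric] field_simps)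
      moreover have "c * (C2' * ln n - 1) \<le> c * R" using R'(2) c by (intro mult_left_mono) auto
      ultimately show ?thesis by (simp add: algebra_simps)
    qed
    finally show ?thesis by (simp only: exp_add pn)
  qed
  have ab: "0 \<le> a" "0 \<le> b" using lnq C2 by (auto simp: a_def b_def)
  have n0: "0 < n" using n by simp
  have "T * N * (2 * R + 4) * (2 * exp (- s / 2)) \<le> (a * n) * n ^ \<kappa> * (b * n) * (2 * (1 / n ^ (\<kappa> + 4)))"
  proof (intro mult_mono)
    show "exp (- s / 2) \<le> 1 / n ^ (\<kappa> + 4)" proof -
      have "- s / 2 = - ((real \<kappa> + 4) * ln n)" by (simp add: s)
      then show ?thesis using pn by (simp only:)
    qed
  qed (use T' N R' ab n0 in auto)
  also have "\<dots> = a * (2 * b) / n\<^sup>2" using n0 by (simp add: field_simps power_add power2_eq_square eval_nat_numeral)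
  finally have 1: "T * N * (2 * R + 4) * (2 * exp (- s / 2)) \<le> a * (2 * b) / n\<^sup>2" .
  have "T * ((1 - c) ^ R * (N * n)) \<le> (a * n) * ((exp c * (1 / n ^ (\<kappa> + 4))) * (n ^ \<kappa> * n))"
    using T' N pR ab n0 c by (intro mult_mono) auto
  also have "\<dots> = a * exp c / n\<^sup>2" using n0 by (simp add: field_simps power_add power2_eq_square eval_nat_numeral)
  finally have 2: "T * ((1 - c) ^ R * (N * n)) \<le> a * exp c / n\<^sup>2" .
  show ?thesis using 1 2
    by (simp add: a_def[symmetric] b_def[symmetric] c_def[symmetric] distrib_left add_divide_distrib)
qed

theorem theorem4p5:
  fixes \<eta> :: real and \<kappa> :: nat
  assumes "0 < \<eta>" and "\<eta> < 1"
  shows "\<forall>\<^sub>F C2' in at_top. \<forall>C1' > 0. \<forall>\<^sub>F C1 in at_top. \<exists>(C :: real) (D :: real) (k :: nat).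
    \<forall>(U :: 'a set) (F :: 'a set set) (rest :: 'a set set \<Rightarrow> 'a set list) (\<epsilon> :: real).
      finite U \<and> card U \<ge> 2 \<and> F \<subseteq> Pow U \<and> card F \<le> card U ^ \<kappa> \<and> \<epsilon> > 0 \<and>
      (\<forall>X. finite X \<longrightarrow> distinct (rest X) \<and> set (rest X) = X) \<longrightarrow>
      \<P>(\<omega> in dp_cover_tape \<eta> C1' U \<epsilon>.
          prefix_optimal F (1 - 5 * \<eta>)
            (C * (ln (real (card U)))\<^sup>2 / eps0 \<eta> (real (card U)) \<epsilon>)
            (dp_cover \<eta> C1 C1' C2' rest U F \<epsilon> \<omega>))
        \<ge> 1 - D * (ln (real (card U))) ^ k / (real (card U))\<^sup>2"
proof (cases "\<eta> < 1 / 5")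
  case False
  show ?thesis
  proof (intro always_eventually allI impI exI[of _ 0], elim conjE)
    fix C2' C1' C1 \<epsilon> :: real and U :: "'a set" and F and rest :: "'a set set \<Rightarrow> 'a set list"
    assume *: "0 < C1'" "finite U" "2 \<le> card U" "F \<subseteq> Pow U" "0 < \<epsilon>"
      "\<forall>X. finite X \<longrightarrow> distinct (rest X) \<and> set (rest X) = X"
    then have "\<P>(\<omega> in dp_cover_tape \<eta> C1' U \<epsilon>. prefix_optimal F (1 - 5 * \<eta>) 0 (dp_cover \<eta> C1 C1' C2' rest U F \<epsilon> \<omega>)) = 1"
      using False assms by (intro prob_prefix_optimal_large_eta) auto
    then show "1 - 0 * ln (real (card U)) ^ 0 / (real (card U))\<^sup>2 \<le>
      \<P>(\<omega> in dp_cover_tape \<eta> C1' U \<epsilon>. prefix_optimal F (1 - 5 * \<eta>)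
        (0 * (ln (real (card U)))\<^sup>2 / eps0 \<eta> (real (card U)) \<epsilon>) (dp_cover \<eta> C1 C1' C2' rest U F \<epsilon> \<omega>))"
      by simp
  qed
next
  case True
  show ?thesis
  proof (rule eventually_mono[OF eventually_ge_at_top[of "(real \<kappa> + 4) / (\<eta>\<^sup>2 / 128)"]], intro allI impI)
    fix C2' C1' :: real
    assume C2': "(real \<kappa> + 4) / (\<eta>\<^sup>2 / 128) \<le> C2'" and C1': "0 < C1'"
    \<comment> \<open>All error terms will be multiples of \<open>(ln n)\<^sup>2 / e0\<close>. In
      \<open>k\<close>, the summand \<open>C1'\<close> comes from the scale \<open>2 / e1\<close>,
      and \<open>1 / ln 2\<close> from the scale \<open>1 / e0\<close>, where
      \<open>ln n \<ge> ln 2\<close> supplies the second logarithm.\<close>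
    define k where "k = 4 * (real \<kappa> + 4) * (C1' + 1 / ln (2::real))"
    define \<theta> where "\<theta> = 6 * C1' / (1 - 3 * \<eta>)"
    \<comment> \<open>The equality case of \<open>\<eta> * M \<ge> 2 * K\<close> plus the threshold
      term, which makes the bound on residual sizes reproduce itself.\<close>
    define m where "m = (2 * k + \<theta>) / \<eta>"
    have k: "0 < k" using C1' by (simp add: k_def add_pos_pos)
    have \<theta>: "0 < \<theta>" using C1' True by (simp add: \<theta>_def)
    have m: "0 < m" "\<eta> * m = 2 * k + \<theta>" using k \<theta> assms by (auto simp: m_def)
    show "\<forall>\<^sub>F C1 in at_top. \<exists>(C :: real) (D :: real) (k :: nat).
    \<forall>(U :: 'a set) (F :: 'a set set) (rest :: 'a set set \<Rightarrow> 'a set list) (\<epsilon> :: real).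
      finite U \<and> card U \<ge> 2 \<and> F \<subseteq> Pow U \<and> card F \<le> card U ^ \<kappa> \<and> \<epsilon> > 0 \<and>
      (\<forall>X. finite X \<longrightarrow> distinct (rest X) \<and> set (rest X) = X) \<longrightarrow>
      \<P>(\<omega> in dp_cover_tape \<eta> C1' U \<epsilon>.
          prefix_optimal F (1 - 5 * \<eta>)
            (C * (ln (real (card U)))\<^sup>2 / eps0 \<eta> (real (card U)) \<epsilon>)
            (dp_cover \<eta> C1 C1' C2' rest U F \<epsilon> \<omega>))
        \<ge> 1 - D * (ln (real (card U))) ^ k / (real (card U))\<^sup>2"
    proof (rule eventually_mono[OF eventually_ge_at_top[of "m + k"]])
      fix C1 assume C1: "m + k \<le> C1"
      \<comment> \<open>The quotient meets the lower bound on \<open>H\<close>; the summand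
        \<open>2 * m\<close> yields \<open>M \<le> 1 / 2\<close> whenever
        \<open>H \<le> 1\<close>.\<close>
      define h where "h = (k / \<eta> + C1 + 2 * k) / (1 - \<eta>) + 2 * m"
      define C where "C = m + C1 + 3 * k + h"
      define D where "D = (1 / ln (1 / (1 - \<eta>)) + 1) * (2 * (2 * C2' + 4) + exp (\<eta>\<^sup>2 / 128))"
      have h: "0 < h" "2 * m \<le> h" "k / \<eta> + C1 + 2 * k \<le> (1 - \<eta>) * h"
      proof -
        have "0 \<le> (k / \<eta> + C1 + 2 * k) / (1 - \<eta>)" using k m C1 assms by (intro divide_nonneg_nonneg) auto
        then show "0 < h" "2 * m \<le> h" using m by (auto simp: h_def)
        have "(1 - \<eta>) * h = k / \<eta> + C1 + 2 * k + (1 - \<eta>) * (2 * m)" using assms unfolding h_def by (subst distrib_left) simp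
        then show "k / \<eta> + C1 + 2 * k \<le> (1 - \<eta>) * h" using assms m by simp
      qed
      have "1 - D * ln (real (card U)) ^ 0 / (real (card U))\<^sup>2 \<le>
          \<P>(\<omega> in dp_cover_tape \<eta> C1' U \<epsilon>. prefix_optimal F (1 - 5 * \<eta>)
            (C * (ln (real (card U)))\<^sup>2 / eps0 \<eta> (real (card U)) \<epsilon>) (dp_cover \<eta> C1 C1' C2' rest U F \<epsilon> \<omega>))"
        if U: "finite U" "2 \<le> card U" "F \<subseteq> Pow U" "card F \<le> card U ^ \<kappa>" and \<epsilon>: "0 < \<epsilon>"
          and rest: "\<And>X. finite X \<Longrightarrow> distinct (rest X) \<and> set (rest X) = X"
        for U :: "'a set" and F and rest :: "'a set set \<Rightarrow> 'a set list" and \<epsilon>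
      proof -
        define n where "n = real (card U)"
        define e0 where "e0 = eps0 \<eta> n \<epsilon>"
        define e1 where "e1 = eps1 C1' n e0"
        define \<Lambda> where "\<Lambda> = (ln n)\<^sup>2 / e0"
        define T where "T = nat \<lceil>log (1 / (1 - \<eta>)) n\<rceil>"
        define s where "s = 2 * (real \<kappa> + 4) * ln n"
        have n: "2 \<le> n" using U by (simp add: n_def)
        have q: "1 < 1 / (1 - \<eta>)" "1 / (1 - \<eta>) < 5 / 4" using assms True by (auto simp: field_simps)
        have ln2: "0 < ln (2::real)" "ln 2 \<le> ln n" "0 < ln n" using n by auto
        have lg: "0 < log (1 / (1 - \<eta>)) n" using q n by simp
        have e: "0 < e0" "0 < e1" using lg \<epsilon> C1' ln2 by (auto simp: e0_def e1_def eps0_def eps1_def)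
        have \<Lambda>: "0 < \<Lambda>" using e ln2 by (simp add: \<Lambda>_def)
        have th: "6 * ln n / ((1 - 3 * \<eta>) * e1) = \<theta> * \<Lambda>"
          using e C1' True by (simp add: e1_def eps1_def \<theta>_def \<Lambda>_def power2_eq_square field_simps)
        have C1\<Lambda>: "C1 * (ln n)\<^sup>2 / e0 = C1 * \<Lambda>" by (simp add: \<Lambda>_def)
        have small: "m * \<Lambda> \<le> 1 / 2" if "h * \<Lambda> \<le> 1"
          using that mult_right_mono[OF h(2), of \<Lambda>] \<Lambda> by linarith
        have Tn: "n \<le> (1 / (1 - \<eta>)) ^ T"
        proof -
          have "n = (1 / (1 - \<eta>)) powr (log (1 / (1 - \<eta>)) n)"
            using q n by (intro powr_log_cancel[symmetric]) linarith+
          also have "\<dots> \<le> (1 / (1 - \<eta>)) powr T"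
            using q lg by (intro powr_mono) (auto simp: T_def)
          also have "\<dots> = (1 / (1 - \<eta>)) ^ T" using assms by (intro powr_realpow) simp
          finally show ?thesis .
        qed
        interpret dp_prob \<eta> n e0 e1 C1 C2' rest U F T "k * \<Lambda>" "m * \<Lambda>" "h * \<Lambda>" "C * \<Lambda>"
        proof unfold_locales
          show "finite U" "F \<subseteq> Pow U" "0 < \<eta>" "\<eta> < 1 / 5" "0 < e0" "0 < e1" by fact+
          show "0 < k * \<Lambda>" using k \<Lambda> by simp
          show "2 * (k * \<Lambda>) + 6 * ln n / ((1 - 3 * \<eta>) * e1) \<le> \<eta> * (m * \<Lambda>)"
            unfolding th mult.assoc[symmetric] m(2) by (simp add: algebra_simps)
          show "0 \<le> 6 * ln n / ((1 - 3 * \<eta>) * e1)" unfolding th using \<theta> \<Lambda> by simp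
          show "m * \<Lambda> + k * \<Lambda> \<le> C1 * (ln n)\<^sup>2 / e0"
            unfolding C1\<Lambda> using mult_right_mono[OF C1, of \<Lambda>] \<Lambda> by (simp add: algebra_simps)
          show "k * \<Lambda> / \<eta> + C1 * (ln n)\<^sup>2 / e0 + 2 * (k * \<Lambda>) \<le> (1 - \<eta>) * (h * \<Lambda>)"
            unfolding C1\<Lambda> using mult_right_mono[OF h(3), of \<Lambda>] \<Lambda> by (simp add: algebra_simps)
          show "1 / (1 - \<eta>) + m * \<Lambda> < 2" if "h * \<Lambda> \<le> 1" using small[OF that] q by simp
          show "(1 - \<eta>) * (1 + k * \<Lambda>) + 6 * ln n / ((1 - 3 * \<eta>) * e1) + k * \<Lambda> < 1" if "h * \<Lambda> \<le> 1"
          proof -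
            \<comment> \<open>With \<open>K = k * \<Lambda>\<close> and
              \<open>M = m * \<Lambda>\<close> the left side of the goal equals
              \<open>1 - \<eta> + \<eta> * M - \<eta> * K\<close>, which is at most
              \<open>1 - \<eta> / 2\<close>.\<close>
            have "\<eta> * (m * \<Lambda>) \<le> \<eta> * (1 / 2)" using small[OF that] assms by (intro mult_left_mono) auto
            moreover have "\<eta> * (m * \<Lambda>) = 2 * (k * \<Lambda>) + \<theta> * \<Lambda>"
              unfolding mult.assoc[symmetric] m(2) by (simp add: algebra_simps)
            moreover have "0 \<le> \<eta> * (k * \<Lambda>)" using assms k \<Lambda> by simp
            moreover have "(1 - \<eta>) * (1 + k * \<Lambda>) = 1 + k * \<Lambda> - \<eta> - \<eta> * (k * \<Lambda>)"
              by (simp add: algebra_simps)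
            ultimately show ?thesis using assms unfolding th by linarith
          qed
          show "m * \<Lambda> + C1 * (ln n)\<^sup>2 / e0 + 3 * (k * \<Lambda>) \<le> C * \<Lambda>"
            unfolding C1\<Lambda> C_def using h \<Lambda> by (simp add: algebra_simps)
          have "0 \<le> (C1 + 3 * k) * \<Lambda>" using C1 m k \<Lambda> by simp
          then show "h * \<Lambda> + m * \<Lambda> \<le> C * \<Lambda>" unfolding C_def by (simp add: algebra_simps)
          show "card U \<le> (1 / (1 - \<eta>)) ^ T" using Tn by (simp add: n_def)
        qed
        have "s / e0 \<le> k * \<Lambda>"
        proof -
          have "1 \<le> ln n / ln 2" using ln2 by simp
          then have "2 * (real \<kappa> + 4) * ln n * 1 \<le> 4 * (real \<kappa> + 4) * ln n * (ln n / ln 2)"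
            using ln2 by (intro mult_mono) auto
          also have "\<dots> \<le> k * (ln n)\<^sup>2" using C1' ln2 by (simp add: k_def field_simps power2_eq_square)
          finally show ?thesis using e by (simp add: s_def \<Lambda>_def divide_right_mono)
        qed
        moreover have "2 * s / e1 \<le> k * \<Lambda>"
        proof -
          have "2 * s / e1 = (4 * (real \<kappa> + 4) * C1') * \<Lambda>"
            using e C1' ln2 by (simp add: s_def e1_def eps1_def \<Lambda>_def power2_eq_square field_simps)
          also have "\<dots> \<le> k * \<Lambda>" using ln2 \<Lambda> by (intro mult_right_mono) (auto simp: k_def)
          finally show ?thesis .
        qed
        moreover have "0 \<le> s" using ln2 by (simp add: s_def)
        moreover have "0 < T" using lg by (simp add: T_def)
        ultimately have "1 - (T * card F * (2 * R + 4) * (2 * exp (- s / 2)) + T * ((1 - \<eta>\<^sup>2 / 128) ^ R * (card F * card U)))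
          \<le> pt.prob {\<omega> \<in> space \<Omega>. prefix_optimal F (1 - 5 * \<eta>) (C * \<Lambda>) (cover \<omega> T U F)}"
          using prob_prefix_optimal[of s] rest by blast
        moreover have "real T * real (card F) * real (2 * R + 4) * (2 * exp (- s / 2)) + T * ((1 - \<eta>\<^sup>2 / 128) ^ R * (card F * n)) \<le> D / n\<^sup>2"
          unfolding D_def
          by (rule failure_bound[OF assms C2' n _ _ R_def T_def s_def])
             (use U in \<open>auto simp: n_def simp flip: of_nat_power\<close>)
        ultimately have "1 - D / n\<^sup>2 \<le> pt.prob {\<omega> \<in> space \<Omega>. prefix_optimal F (1 - 5 * \<eta>) (C * \<Lambda>) (cover \<omega> T U F)}"
          by (simp add: n_def)
        moreover have "dp_cover_tape \<eta> C1' U \<epsilon> = \<Omega>"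
          by (simp only: dp_cover_tape_def Let_def n_def e0_def e1_def)
        moreover have "dp_cover \<eta> C1 C1' C2' rest U F \<epsilon> \<omega> = cover \<omega> T U F" for \<omega>
          by (simp only: dp_cover_def Let_def n_def e0_def e1_def T_def)
        moreover have "C * (ln (real (card U)))\<^sup>2 / eps0 \<eta> (real (card U)) \<epsilon> = C * \<Lambda>"
          by (simp add: \<Lambda>_def e0_def n_def)
        moreover have "D * ln (real (card U)) ^ 0 / (real (card U))\<^sup>2 = D / n\<^sup>2"
          by (simp add: n_def)
        ultimately show ?thesis by (simp only:)
      qed
      then show "\<exists>(C :: real) (D :: real) (k :: nat).
    \<forall>(U :: 'a set) (F :: 'a set set) (rest :: 'a set set \<Rightarrow> 'a set list) (\<epsilon> :: real).
      finite U \<and> card U \<ge> 2 \<and> F \<subseteq> Pow U \<and> card F \<le> card U ^ \<kappa> \<and> \<epsilon> > 0 \<and>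
      (\<forall>X. finite X \<longrightarrow> distinct (rest X) \<and> set (rest X) = X) \<longrightarrow>
      \<P>(\<omega> in dp_cover_tape \<eta> C1' U \<epsilon>.
          prefix_optimal F (1 - 5 * \<eta>)
            (C * (ln (real (card U)))\<^sup>2 / eps0 \<eta> (real (card U)) \<epsilon>)
            (dp_cover \<eta> C1 C1' C2' rest U F \<epsilon> \<omega>))
        \<ge> 1 - D * (ln (real (card U))) ^ k / (real (card U))\<^sup>2"
        by (intro exI[of _ C] exI[of _ D] exI[of _ 0] allI impI) (elim conjE, simp only:)
    qed
  qed
qed

end
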